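(* Let $1<p,\tau<\infty$, $0<\theta\le\infty$, $b_j>-\frac1\theta$ for $j=1,\dots,m$, $\overline b=(b_1,\dots,b_m)$, and $\min\{2,\tau,\theta\}=2$. Suppose that either $1<\tau\le2$ and $1<p<\infty$, or $2<\tau<\infty$ and $2<p<\infty$, and put $$\beta=\begin{cases}\tau,&\text{if }1<\tau\le2\text{ and }1<p<\infty,\\2,&\text{if }2<\tau<\infty\text{ and }2<p<\infty,\end{cases}$$ $v_j=b_j+\frac1{\min\{\beta,\theta\}}$ for $j=1,\dots,m$, and $\overline v=(v_1,\dots,v_m)$. Let $j_0\in\{1,\dots,m\}$ and let $\overline e_{j_0}\in\mathbb{R}^m$ be the point with coordinates $x_j=0$ for $j\ne j_0$ and $x_{j_0}=1$. Then for any number $\varepsilon>0$ there is a function $f\in S^{0,\overline v-\varepsilon\overline e_{j_0}}_{p,\tau,\theta}B$ such that $f\notin S^{0,\overline b}_{p,\tau,\theta}\mathbf{B}$.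
   Context: $m\in\mathbb{N}$, $\mathbb{T}^m=[0,2\pi)^m$, $\mathbb{Z}_+=\mathbb{N}\cup\{0\}$; $\log$ is the logarithm to base 2; $1/\infty=0$. For $1<p<\infty$, $1\le\tau<\infty$, $L_{p,\tau}(\mathbb{T}^m)$ is the Lorentz space of real-valued measurable functions $f$, $2\pi$-periodic in each variable, with $$\|f\|_{p,\tau}=\Bigl\{\frac{\tau}{p}\int_0^1 (f^*(t))^\tau t^{\frac{\tau}{p}-1}dt\Bigr\}^{1/\tau}<\infty,$$ where $f^*$ is the non-increasing rearrangement of $|f(2\pi\overline x)|$, $\overline x\in[0,1)^m$. $\mathring L_{p,\tau}(\mathbb{T}^m)$ is the set of $f\in L_{p,\tau}(\mathbb{T}^m)$ with $\int_0^{2\pi}f(\overline x)\,dx_j=0$ for $j=1,\dots,m$. For $\overline s\in\mathbb{Z}_+^m$ let $\rho(\overline s)=\{\overline k\in\mathbb{Z}^m: [2^{s_j-1}]\le|k_j|<2^{s_j},\ j=1,\dots,m\}$ ($[a]$ is the integer part of $a$) and $\delta_{\overline s}(f,\overline x)=\sum_{\overline n\in\rho(\overline s)}a_{\overline n}(f)e^{i\langle\overline n,\overline x\rangle}$, where $a_{\overline n}(f)$ are the Fourier coefficients of $f$ with respect to the trigonometric system. For $\overline r=(r_1,\dots,r_m)\in\mathbb{R}^m$, $S^{0,\overline r}_{p,\tau,\theta}B$ is the set of all $f\in\mathring L_{p,\tau}(\mathbb{T}^m)$ with $$\|f\|_{S^{0,\overline r}_{p,\tau,\theta}B}=\Bigl\{\sum_{\overline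 s\in\mathbb{Z}_+^m}\prod_{j=1}^m(s_j+1)^{r_j\theta}\|\delta_{\overline s}(f)\|_{p,\tau}^\theta\Bigr\}^{1/\theta}<\infty.$$ For $\overline k\in\mathbb{N}^m$ the mixed modulus of smoothness is $\omega_{\overline k}(f,\overline t)_{p,\tau}=\sup_{|h_1|\le t_1,\dots,|h_m|\le t_m}\|\Delta_{\overline h}^{\overline k}f\|_{p,\tau}$, where $\Delta_{\overline h}^{\overline k}f=\Delta_{h_m}^{k_m}(\cdots\Delta_{h_1}^{k_1}f)$ and $\Delta_{h_j}^{k_j}$ is the difference of order $k_j$ with step $h_j$ in the variable $x_j$. With $\overline k\in\mathbb{N}^m$ fixed, $S^{0,\overline b}_{p,\tau,\theta}\mathbf{B}$ is the space of all $f\in\mathring L_{p,\tau}(\mathbb{T}^m)$ with $$\|f\|_{S^{0,\overline b}_{p,\tau,\theta}\mathbf{B}}=\|f\|_{p,\tau}+\Bigl[\int_0^1\cdots\int_0^1\omega_{\overline k}^\theta(f,\overline t)_{p,\tau}\prod_{j=1}^m\frac{(1-\log t_j)^{\theta b_j}}{t_j}dt_1\cdots dt_m\Bigr]^{1/\theta}<\infty.$$ When $\theta=\infty$, the $\theta$-sums and $\theta$-integrals are replaced by suprema in the usual way. *)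

theory Defs
  imports "HOL-Analysis.Analysis"
begin

text \<open>
  Points of $\mathbb{R}^m$ are vectors of type \<open>real ^ 'm\<close>, with \<open>m = CARD('m)\<close>.  All norms take
  values in \<open>ennreal\<close>, so that membership in a space means that the norm is finite.
  All integrals over $\mathbb{R}^m$ are taken with respect to the completed measure \<open>lebesgue\<close>,
  because functions are only required to be Lebesgue measurable.
\<close>

text \<open>Used for positive exponents only.\<close>

definition ennreal_powr :: "ennreal \<Rightarrow> real \<Rightarrow> ennreal" where
  "ennreal_powr x a = (if x = \<infinity> then \<infinity> else ennreal (enn2real x powr a))"


subsection \<open>Lorentz spaces on the torus\<close>

text \<open>
  For measurable \<open>f\<close> and \<open>t > 0\<close> the set below is nonempty, because \<open>f\<close> is finite everywhere and the
  unit cube has finite measure; hence the infimum is a genuine real number.  The value at \<open>t = 0\<close> is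
  never used.
\<close>

definition rearrangement :: "(real ^ 'm \<Rightarrow> 'a::real_normed_vector) \<Rightarrow> real \<Rightarrow> real" where
  "rearrangement f t =
     Inf {y. 0 \<le> y \<and>
       measure lebesgue {x. (\<forall>j. 0 \<le> x $ j \<and> x $ j < 1) \<and> y < norm (f ((2 * pi) *\<^sub>R x))} \<le> t}"

definition lorentz_norm ::
    "real \<Rightarrow> real \<Rightarrow> (real ^ 'm \<Rightarrow> 'a::real_normed_vector) \<Rightarrow> ennreal" where
  "lorentz_norm p \<tau> f =
     ennreal_powr
       (ennreal (\<tau> / p) *
         (\<integral>\<^sup>+ t\<in>{0<..<1}. ennreal ((rearrangement f t) powr \<tau> * t powr (\<tau> / p - 1)) \<partial>lborel))
       (1 / \<tau>)"

definition lorentz_space :: "real \<Rightarrow> real \<Rightarrow> (real ^ 'm \<Rightarrow> real) set" where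
  "lorentz_space p \<tau> =
     {f. f \<in> borel_measurable lebesgue \<and>
         (\<forall>j x. f (x + axis j (2 * pi)) = f x) \<and>
         lorentz_norm p \<tau> f < \<infinity>}"

text \<open>
  As elements of the Lorentz space are determined up to null sets, the vanishing of the integral in
  the variable \<open>x\<^sub>j\<close> is required for almost all values of the remaining variables (the coordinate
  \<open>x $ j\<close> is a dummy).  For \<open>p > 1\<close> the functions are integrable over the torus, so by Fubini almost
  all of these one-dimensional integrals exist.
\<close>

definition lorentz_space0 :: "real \<Rightarrow> real \<Rightarrow> (real ^ 'm \<Rightarrow> real) set" where
  "lorentz_space0 p \<tau> =
     {f \<in> lorentz_space p \<tau>.
        \<forall>j. AE x in lebesgue. (LINT u:{0..2 * pi}|lebesgue. f (\<chi> i. if i = j then u else x $ i)) = 0}"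


subsection \<open>Dyadic blocks of Fourier series and the first scale of spaces\<close>

definition dyadic_block :: "nat ^ 'm \<Rightarrow> (int ^ 'm) set" where
  "dyadic_block s =
     {k. \<forall>j. \<lfloor>(2::real) powr (real (s $ j) - 1)\<rfloor> \<le> \<bar>k $ j\<bar> \<and> \<bar>k $ j\<bar> < 2 ^ (s $ j)}"

definition trig_character :: "int ^ 'm \<Rightarrow> real ^ 'm \<Rightarrow> complex" where
  "trig_character n x = exp (\<i> * complex_of_real (\<Sum>j\<in>UNIV. real_of_int (n $ j) * x $ j))"

definition fourier_coeff :: "(real ^ 'm \<Rightarrow> real) \<Rightarrow> int ^ 'm \<Rightarrow> complex" where
  "fourier_coeff f n =
     (LINT x:{x. \<forall>j. 0 \<le> x $ j \<and> x $ j < 2 * pi}|lebesgue. f x * trig_character (- n) x)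
       / (2 * pi) ^ CARD('m)"

text \<open>
  For real-valued \<open>f\<close> this is real-valued, since \<open>dyadic_block s\<close> is symmetric; it is nevertheless
  kept as a complex-valued function.
\<close>

definition delta_block :: "nat ^ 'm \<Rightarrow> (real ^ 'm \<Rightarrow> real) \<Rightarrow> real ^ 'm \<Rightarrow> complex" where
  "delta_block s f x = (\<Sum>n\<in>dyadic_block s. fourier_coeff f n * trig_character n x)"

definition SB_norm ::
    "real \<Rightarrow> real \<Rightarrow> ereal \<Rightarrow> real ^ 'm \<Rightarrow> (real ^ 'm \<Rightarrow> real) \<Rightarrow> ennreal" where
  "SB_norm p \<tau> \<theta> r f =
     (if \<theta> = \<infinity> then
        (SUP s. ennreal (\<Prod>j\<in>UNIV. (real (s $ j) + 1) powr (r $ j))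
                  * lorentz_norm p \<tau> (delta_block s f))
      else
        (let q = real_of_ereal \<theta> in
          ennreal_powr
            (\<Sum>\<^sub>\<infinity>s. ennreal (\<Prod>j\<in>UNIV. (real (s $ j) + 1) powr (r $ j * q))
                    * ennreal_powr (lorentz_norm p \<tau> (delta_block s f)) q)
            (1 / q)))"

definition SB_space :: "real \<Rightarrow> real \<Rightarrow> ereal \<Rightarrow> real ^ 'm \<Rightarrow> (real ^ 'm \<Rightarrow> real) set" where
  "SB_space p \<tau> \<theta> r = {f \<in> lorentz_space0 p \<tau>. SB_norm p \<tau> \<theta> r f < \<infinity>}"


subsection \<open>Mixed moduli of smoothness and the second scale of spaces\<close>

definition coord_difference ::
    "real ^ 'm \<Rightarrow> 'm \<Rightarrow> (real ^ 'm \<Rightarrow> real) \<Rightarrow> real ^ 'm \<Rightarrow> real" where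
  "coord_difference h j f = (\<lambda>x. f (x + axis j (h $ j)) - f x)"

text \<open>
  The composition of the operators \<open>coord_difference h j ^^ (k $ j)\<close> over all coordinates \<open>j\<close>.  The
  index type carries no order, but none is needed: the operators commute.
\<close>

definition mixed_difference ::
    "nat ^ 'm \<Rightarrow> real ^ 'm \<Rightarrow> (real ^ 'm \<Rightarrow> real) \<Rightarrow> real ^ 'm \<Rightarrow> real" where
  "mixed_difference k h f = Finite_Set.fold (\<lambda>j. coord_difference h j ^^ (k $ j)) f UNIV"

lemma comp_fun_commute_coord_difference: "comp_fun_commute (coord_difference h)"
  by standard (auto simp: coord_difference_def fun_eq_iff algebra_simps)

lemma comp_fun_commute_mixed_difference:
  "comp_fun_commute (\<lambda>j. coord_difference h j ^^ (k $ j))"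
  by (rule comp_fun_commute.comp_fun_commute_funpow[OF comp_fun_commute_coord_difference])

definition mixed_modulus ::
    "nat ^ 'm \<Rightarrow> real \<Rightarrow> real \<Rightarrow> (real ^ 'm \<Rightarrow> real) \<Rightarrow> real ^ 'm \<Rightarrow> ennreal" where
  "mixed_modulus k p \<tau> f t =
     (SUP h\<in>{h. \<forall>j. \<bar>h $ j\<bar> \<le> t $ j}. lorentz_norm p \<tau> (mixed_difference k h f))"

text \<open>The point \<open>t\<^sub>j = 0\<close>, where the weight is singular, is left out of the range of integration.\<close>

definition SB_modulus_norm ::
    "nat ^ 'm \<Rightarrow> real \<Rightarrow> real \<Rightarrow> ereal \<Rightarrow> real ^ 'm \<Rightarrow> (real ^ 'm \<Rightarrow> real) \<Rightarrow> ennreal" where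
  "SB_modulus_norm k p \<tau> \<theta> b f =
     lorentz_norm p \<tau> f +
     (if \<theta> = \<infinity> then
        (SUP t\<in>{t. \<forall>j. 0 < t $ j \<and> t $ j \<le> 1}.
           mixed_modulus k p \<tau> f t * ennreal (\<Prod>j\<in>UNIV. (1 - log 2 (t $ j)) powr (b $ j)))
      else
        (let q = real_of_ereal \<theta> in
          ennreal_powr
            (\<integral>\<^sup>+ t\<in>{t. \<forall>j. 0 < t $ j \<and> t $ j \<le> 1}.
               (ennreal_powr (mixed_modulus k p \<tau> f t) q
                 * ennreal (\<Prod>j\<in>UNIV. (1 - log 2 (t $ j)) powr (q * b $ j) / t $ j)) \<partial>lebesgue)
            (1 / q)))"

definition SB_modulus_space ::
    "nat ^ 'm \<Rightarrow> real \<Rightarrow> real \<Rightarrow> ereal \<Rightarrow> real ^ 'm \<Rightarrow> (real ^ 'm \<Rightarrow> real) set" where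
  "SB_modulus_space k p \<tau> \<theta> b = {f \<in> lorentz_space0 p \<tau>. SB_modulus_norm k p \<tau> \<theta> b f < \<infinity>}"

end

theory Submission
  imports Defs
begin

text \<open>
  Under the hypotheses \<open>\<beta> = 2\<close> and \<open>\<theta> \<ge> 2\<close>, so \<open>v\<^sub>j = b\<^sub>j + 1 / 2\<close>.  With \<open>i = j\<^sub>0\<close>, take the lacunary series
  with terms \<open>(s + 1) powr (- \<gamma>) * cos (4 ^ s * x\<^sub>i + (\<Sum>j\<in>- {i}. x\<^sub>j))\<close>.  Each dyadic block contains
  at most one term, so the first norm only sees the \<open>\<ell>\<^sub>\<theta>\<close> norm of the weighted coefficients.  The modulus
  of smoothness at \<open>t\<^sub>i = 4 powr (- r)\<close> sees the \<open>\<ell>\<^sub>2\<close> norm of the tail of the coefficients, which is of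
  order \<open>r powr (1 / 2 - \<gamma>)\<close>: half a power more than a single coefficient.  Hence \<open>\<gamma> = b\<^sub>i + 1 / 2 + 1 / \<theta>\<close>
  (slightly less if \<open>\<theta> = \<infinity>\<close>) makes the second norm infinite, while the first one stays finite
  thanks to \<open>\<epsilon>\<close>; and \<open>b\<^sub>i > - 1 / \<theta>\<close> gives \<open>\<gamma> > 1 / 2\<close>, so the coefficients are square summable.

  That all \<open>L\<^sub>p\<^sub>,\<^sub>\<tau>\<close> norms of lacunary sums are comparable to the \<open>\<ell>\<^sub>2\<close> norm of the coefficients follows
  from Riesz products: \<open>exp u \<le> (1 + u) * exp (2 * u\<^sup>2)\<close> for small \<open>u\<close>, and the products of the
  factors \<open>1 + u\<^sub>s\<close> have mean 1.  This bounds the exponential moments, hence all even moments and the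
  tails from above, and the Paley--Zygmund inequality bounds the tails from below.
\<close>

subsection \<open>Normalised integration over the torus\<close>

definition unit_cube :: "(real ^ 'm) set" where
  "unit_cube = {x. \<forall>j. 0 \<le> x $ j \<and> x $ j < 1}"

text \<open>The normalised Haar measure of the torus, carried by the cube of side
  \<open>2 * pi\<close> but living on all Borel sets of \<open>real ^ 'm\<close>. Starting from the
  unit cube makes its level sets agree with those in \<open>rearrangement\<close>.\<close>

definition torus :: "(real ^ 'm) measure" where
  "torus = distr (restrict_space lborel unit_cube) borel (\<lambda>x. (2 * pi) *\<^sub>R x)"

lemma unit_cube_borel [measurable]: "(unit_cube :: (real ^ 'm) set) \<in> sets borel"
proof -
  have "unit_cube = (\<Inter>j. {x :: real ^ 'm. 0 \<le> x $ j \<and> x $ j < 1})"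
    by (auto simp: unit_cube_def)
  also have "\<dots> \<in> sets borel"
    by measurable
  finally show ?thesis .
qed

lemma emeasure_unit_cube: "emeasure lborel (unit_cube :: (real ^ 'm) set) = 1"
proof (rule antisym)
  have *: "unit_cube \<subseteq> (cbox 0 (\<chi> j. 1) :: (real ^ 'm) set)" "box 0 (\<chi> j. 1) \<subseteq> (unit_cube :: (real ^ 'm) set)"
    by (auto simp: unit_cube_def mem_box_cart less_imp_le)
  have "measure lborel (cbox 0 (\<chi> j. 1) :: (real ^ 'm) set) = 1"
    by (subst content_cbox_cart) (auto simp: interval_ne_empty_cart)
  then have 1: "emeasure lborel (cbox 0 (\<chi> j. 1) :: (real ^ 'm) set) = 1"
    by (metis emeasure_eq_ennreal_measure emeasure_lborel_cbox_finite ennreal_1 infinity_ennreal_def less_irrefl)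
  have 2: "emeasure lborel (box 0 (\<chi> j. 1) :: (real ^ 'm) set) = 1"
    using 1 by (simp add: emeasure_lborel_box_eq emeasure_lborel_cbox_eq)
  show "emeasure lborel (unit_cube :: (real ^ 'm) set) \<le> 1"
    using emeasure_mono[OF *(1), of lborel] 1 by simp
  show "1 \<le> emeasure lborel (unit_cube :: (real ^ 'm) set)"
    using emeasure_mono[OF *(2), of lborel] 2 by simp
qed

lemma sets_torus [measurable_cong, simp]: "sets torus = sets borel"
  and space_torus [simp]: "space torus = UNIV"
  by (auto simp: torus_def)

lemma torus_scale_measurable [measurable]:
  "(\<lambda>x. (2 * pi) *\<^sub>R x) \<in> measurable (restrict_space lborel unit_cube) (borel :: (real ^ 'm) measure)"
  by (rule measurable_restrict_space1) simp

lemma finite_measure_torus: "finite_measure (torus :: (real ^ 'm) measure)"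
  and measure_torus_UNIV: "measure (torus :: (real ^ 'm) measure) UNIV = 1"
proof -
  have "emeasure (torus :: (real ^ 'm) measure) UNIV = 1"
    unfolding torus_def
    by (subst emeasure_distr) (auto simp: space_restrict_space emeasure_restrict_space emeasure_unit_cube)
  then show "finite_measure (torus :: (real ^ 'm) measure)" "measure (torus :: (real ^ 'm) measure) UNIV = 1"
    by (auto intro!: finite_measureI simp: measure_def)
qed

interpretation torus: finite_measure torus
  by (rule finite_measure_torus)

lemma torus_integral:
  fixes F :: "real ^ 'm \<Rightarrow> 'b :: {banach, second_countable_topology}"
  assumes [measurable]: "F \<in> borel_measurable borel"
  shows "(\<integral>x. F x \<partial>torus) = (\<integral>x. indicator unit_cube x *\<^sub>R F ((2 * pi) *\<^sub>R x) \<partial>lborel)"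
  unfolding torus_def by (subst integral_distr) (auto simp: integral_restrict_space)

text \<open>Translates between \<open>torus\<close> and the level sets in the definition of
  \<open>rearrangement\<close>.\<close>

lemma measure_torus:
  fixes S :: "(real ^ 'm) set"
  assumes [measurable]: "S \<in> sets borel"
  shows "measure torus S = measure lebesgue {x. (\<forall>j. 0 \<le> x $ j \<and> x $ j < 1) \<and> (2 * pi) *\<^sub>R x \<in> S}"
proof -
  have *: "{x. (\<forall>j. 0 \<le> x $ j \<and> x $ j < 1) \<and> (2 * pi) *\<^sub>R x \<in> S} = (\<lambda>x. (2 * pi) *\<^sub>R x) -` S \<inter> unit_cube"
    by (auto simp: unit_cube_def)
  have "(\<lambda>x. (2 * pi) *\<^sub>R x) -` S \<inter> space borel \<in> sets borel"
    by measurable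
  then have m: "(\<lambda>x. (2 * pi) *\<^sub>R x) -` S \<inter> unit_cube \<in> sets borel"
    by auto
  have "measure torus S = measure lborel ((\<lambda>x. (2 * pi) *\<^sub>R x) -` S \<inter> unit_cube)"
    unfolding torus_def by (subst measure_distr) (auto simp: space_restrict_space measure_restrict_space Int_commute)
  then show ?thesis using m by (simp add: *)
qed

section \<open>Translation invariance on the torus\<close>

lemma lborel_integral_translate:
  fixes g :: "'a :: euclidean_space \<Rightarrow> 'b :: {banach, second_countable_topology}"
  assumes [measurable]: "g \<in> borel_measurable borel"
  shows "(\<integral>x. g (x + c) \<partial>lborel) = (\<integral>x. g x \<partial>lborel)"
proof -
  have "(\<integral>x. g x \<partial>lborel) = (\<integral>x. g x \<partial>distr lborel borel ((+) c))"
    by (simp add: lborel_distr_plus)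
  then show ?thesis by (simp add: integral_distr add.commute)
qed

text \<open>The shifted cube differs from the cube only in direction \<open>j\<close>. The part
  sticking out, with \<open>j\<close>-coordinate in \<open>[1, 1 + d)\<close>, is moved back by one
  period and fills the missing part \<open>[0, d)\<close>.\<close>

lemma torus_integral_shift:
  fixes F :: "real ^ 'm \<Rightarrow> 'b :: {banach, second_countable_topology}"
  assumes F [measurable]: "F \<in> borel_measurable borel" and bound: "\<And>x. norm (F x) \<le> B"
    and periodic: "\<And>x. F (x + axis j (2 * pi)) = F x" and c: "0 \<le> c" "c \<le> 2 * pi"
  shows "(\<integral>x. F (x + axis j c) \<partial>torus) = (\<integral>x. F x \<partial>torus)"
proof -
  define G where "G x = F ((2 * pi) *\<^sub>R x)" for x
  define d where "d = c / (2 * pi)"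
  have d: "0 \<le> d" "d \<le> 1" using c by (auto simp: d_def)
  have [measurable]: "G \<in> borel_measurable borel" unfolding G_def by measurable
  have axis: "(2 * pi) *\<^sub>R axis j y = axis j (2 * pi * y)" for y :: real
    by (simp add: axis_def vec_eq_iff)
  have G1: "G (x + axis j 1) = G x" for x
    using periodic[of "(2 * pi) *\<^sub>R x"] by (simp add: G_def scaleR_add_right axis)
  have Gd: "G (x + axis j d) = F ((2 * pi) *\<^sub>R x + axis j c)" for x
    by (simp add: G_def scaleR_add_right axis d_def)
  \<comment> \<open>Half-open in direction \<open>j\<close>, so that adjacent slabs are disjoint and
    the indicator of their union splits at every point.\<close>
  define slab where "slab u v = {x :: real ^ 'm. (\<forall>i. i \<noteq> j \<longrightarrow> 0 \<le> x $ i \<and> x $ i < 1) \<and> u \<le> x $ j \<and> x $ j < v}"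
    for u v
  have [measurable]: "slab u v \<in> sets borel" for u v
  proof -
    have "slab u v = (\<Inter>i. {x :: real ^ 'm. i \<noteq> j \<longrightarrow> 0 \<le> x $ i \<and> x $ i < 1}) \<inter> {x. u \<le> x $ j \<and> x $ j < v}"
      by (auto simp: slab_def)
    also have "\<dots> \<in> sets borel" by measurable
    finally show ?thesis .
  qed
  have cube: "unit_cube = slab 0 1"
    unfolding unit_cube_def slab_def by (metis (no_types, lifting))
  have int: "integrable lborel (\<lambda>x. indicator (slab u v) x *\<^sub>R G x)" for u v
  proof (rule integrableI_bounded_set_indicator)
    have "slab u v \<subseteq> cbox (\<chi> i. if i = j then u else 0) (\<chi> i. if i = j then v else 1)"
      by (auto simp: slab_def mem_box_cart less_imp_le)
    then have "emeasure lborel (slab u v) \<le> emeasure lborel (cbox (\<chi> i. if i = j then u else 0) (\<chi> i. if i = j then v else 1) :: (real ^ 'm) set)"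
      by (rule emeasure_mono) simp
    then show "emeasure lborel (slab u v) < \<infinity>"
      using emeasure_lborel_cbox_finite by (rule order_le_less_trans)
    show "AE x in lborel. x \<in> slab u v \<longrightarrow> norm (G x) \<le> B"
      using bound by (simp add: G_def)
  qed auto
  have slab_shift: "x + axis j y \<in> slab u v \<longleftrightarrow> x \<in> slab (u - y) (v - y)" for x y u v
    by (auto simp: slab_def axis_def algebra_simps)
  have split: "indicator (slab u w) x *\<^sub>R G x = indicator (slab u v) x *\<^sub>R G x + indicator (slab v w) x *\<^sub>R G x"
    if "u \<le> v" "v \<le> w" for u v w x
    using that by (auto simp: slab_def indicator_def)
  have "(\<integral>x. F (x + axis j c) \<partial>torus) = (\<integral>x. indicator (slab 0 1) x *\<^sub>R G (x + axis j d) \<partial>lborel)"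
    by (simp add: torus_integral Gd cube)
  also have "\<dots> = (\<integral>x. indicator (slab d (1 + d)) (x + axis j d) *\<^sub>R G (x + axis j d) \<partial>lborel)"
    by (simp add: slab_shift indicator_def)
  also have "\<dots> = (\<integral>x. indicator (slab d (1 + d)) x *\<^sub>R G x \<partial>lborel)"
    by (rule lborel_integral_translate) measurable
  also have "\<dots> = (\<integral>x. indicator (slab d 1) x *\<^sub>R G x \<partial>lborel) + (\<integral>x. indicator (slab 1 (1 + d)) x *\<^sub>R G x \<partial>lborel)"
    using d by (subst split[of d 1 "1 + d"]) (auto intro!: Bochner_Integration.integral_add int)
  also have "(\<integral>x. indicator (slab 1 (1 + d)) x *\<^sub>R G x \<partial>lborel)
      = (\<integral>x. indicator (slab 1 (1 + d)) (x + axis j 1) *\<^sub>R G (x + axis j 1) \<partial>lborel)"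
    by (rule lborel_integral_translate[symmetric]) measurable
  also have "\<dots> = (\<integral>x. indicator (slab 0 d) x *\<^sub>R G x \<partial>lborel)"
    by (simp add: slab_shift G1 indicator_def)
  also have "(\<integral>x. indicator (slab d 1) x *\<^sub>R G x \<partial>lborel) + \<dots> = (\<integral>x. indicator (slab 0 1) x *\<^sub>R G x \<partial>lborel)"
    using d by (subst split[of 0 d 1]) (auto intro!: Bochner_Integration.integral_add[symmetric] int simp: add.commute)
  also have "\<dots> = (\<integral>x. F x \<partial>torus)"
    by (simp add: torus_integral G_def cube)
  finally show ?thesis .
qed

lemma torus_integrable_bounded:
  fixes F :: "real ^ 'm \<Rightarrow> 'b :: {banach, second_countable_topology}"
  assumes "F \<in> borel_measurable borel" and "\<And>x. norm (F x) \<le> B"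
  shows "integrable torus F"
  using assms by (intro torus.integrable_const_bound[of _ B]) auto

text \<open>By translation invariance the integral equals its own negative. All orthogonality
  relations between distinct frequencies below come from this symmetry.\<close>

lemma torus_integral_zero_shift:
  fixes F :: "real ^ 'm \<Rightarrow> 'b :: {banach, second_countable_topology}"
  assumes "F \<in> borel_measurable borel" and "\<And>x. norm (F x) \<le> B"
    and "\<And>x. F (x + axis j (2 * pi)) = F x" and "0 \<le> c" "c \<le> 2 * pi"
    and "\<And>x. F (x + axis j c) = - F x"
  shows "(\<integral>x. F x \<partial>torus) = 0"
proof -
  have "(\<integral>x. F x \<partial>torus) = - (\<integral>x. F x \<partial>torus)"
    using torus_integral_shift[of F B j c, OF assms(1-5)] assms(6) by simp
  then have "2 *\<^sub>R (\<integral>x. F x \<partial>torus) = 0"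
    by (metis add.right_inverse scaleR_2)
  then show ?thesis by simp
qed

text \<open>The change of variables behind \<open>fourier_coeff\<close>: scaling the unit cube by
  \<open>2 * pi\<close> has Jacobian \<open>(2 * pi) ^ CARD('m)\<close>, which cancels the
  normalising factor there.\<close>

lemma torus_integral_lebesgue:
  fixes F :: "real ^ 'm \<Rightarrow> complex"
  assumes [measurable]: "F \<in> borel_measurable borel"
  shows "(LINT x:{x. \<forall>j. 0 \<le> x $ j \<and> x $ j < 2 * pi}|lebesgue. F x) = (2 * pi) ^ CARD('m) * (\<integral>x. F x \<partial>torus)"
proof -
  let ?Q = "{x :: real ^ 'm. \<forall>j. 0 \<le> x $ j \<and> x $ j < 2 * pi}"
  have "?Q = (\<Inter>j. {x. 0 \<le> x $ j \<and> x $ j < 2 * pi})" by auto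
  also have "\<dots> \<in> sets borel" by measurable
  finally have [measurable]: "?Q \<in> sets borel" .
  have Q: "x \<in> ?Q \<longleftrightarrow> (1 / (2 * pi)) *\<^sub>R x \<in> unit_cube" for x
    by (auto simp: unit_cube_def field_simps)
  have Q2: "indicator ?Q ((2 * pi) *\<^sub>R x) = (indicator unit_cube x :: real)" for x
    using Q[of "(2 * pi) *\<^sub>R x"] by (simp add: indicator_def)
  define H where "H x = indicator ?Q x *\<^sub>R F x" for x
  have [measurable]: "H \<in> borel_measurable borel" unfolding H_def by measurable
  have "(LINT x:?Q|lebesgue. F x) = (\<integral>x. H x \<partial>lborel)"
    unfolding set_lebesgue_integral_def H_def by (subst integral_completion) auto
  also have "\<dots> = (\<integral>x. H x \<partial>density (distr lborel borel (\<lambda>x. 0 + (2 * pi) *\<^sub>R x)) (\<lambda>_. \<bar>2 * pi\<bar> ^ DIM(real ^ 'm)))"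
    by (subst lborel_affine[of "2 * pi" 0]) auto
  also have "\<dots> = (2 * pi) ^ CARD('m) *\<^sub>R (\<integral>x. H ((2 * pi) *\<^sub>R x) \<partial>lborel)"
    by (subst integral_density) (auto simp: integral_distr)
  also have "(\<integral>x. H ((2 * pi) *\<^sub>R x) \<partial>lborel) = (\<integral>x. F x \<partial>torus)"
    unfolding torus_integral[OF assms] H_def by (simp only: Q2)
  finally show ?thesis by (simp add: scaleR_conv_of_real)
qed

subsection \<open>Lacunary sums of characters\<close>

lemma norm_trig_character [simp]: "norm (trig_character n x) = 1"
  unfolding trig_character_def by (rule norm_exp_i_times)

lemma trig_character_add: "trig_character n (x + y) = trig_character n x * trig_character n y"
  by (simp add: trig_character_def exp_add[symmetric] algebra_simps sum.distrib)

lemma trig_character_add_index: "trig_character (m + n) x = trig_character m x * trig_character n x"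
  by (simp add: trig_character_def exp_add[symmetric] algebra_simps sum.distrib)

lemma trig_character_uminus: "trig_character (- n) x = cnj (trig_character n x)"
  by (simp add: trig_character_def exp_cnj sum_negf)

lemma trig_character_zero [simp]: "trig_character 0 x = 1"
  by (simp add: trig_character_def)

lemma trig_character_axis: "trig_character n (axis j c) = exp (\<i> * complex_of_real (real_of_int (n $ j) * c))"
proof -
  have "(\<Sum>i\<in>UNIV. real_of_int (n $ i) * axis j c $ i) = (\<Sum>i\<in>UNIV. if i = j then real_of_int (n $ j) * c else 0)"
    by (intro sum.cong) (auto simp: axis_def)
  then show ?thesis
    by (simp add: trig_character_def)
qed

lemma trig_character_2pi: "trig_character n (axis j (2 * pi)) = 1"
  unfolding trig_character_axis by (simp add: exp_eq_1)

lemma trig_character_measurable [measurable]: "trig_character n \<in> borel_measurable borel"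
  unfolding trig_character_def by measurable

text \<open>If some coordinate of \<open>n\<close> is nonzero, a shift by half a period in that
  coordinate changes the sign of the character.\<close>

lemma torus_integral_trig_character:
  "(\<integral>x. trig_character n x \<partial>torus) = (if n = 0 then 1 else 0)"
proof (cases "n = 0")
  case True
  then show ?thesis by (simp add: measure_torus_UNIV)
next
  case False
  then obtain j where j: "n $ j \<noteq> 0" by (auto simp: vec_eq_iff)
  define c where "c = pi / \<bar>real_of_int (n $ j)\<bar>"
  have "1 \<le> \<bar>real_of_int (n $ j)\<bar>" using j by linarith
  then have c: "0 \<le> c" "c \<le> 2 * pi"
    by (auto simp: c_def field_simps intro: order_trans[of _ "pi * 1"] mult_left_mono)
  have "real_of_int (n $ j) * c = pi \<or> real_of_int (n $ j) * c = - pi"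
    using j by (auto simp: c_def abs_if)
  then have "trig_character n (axis j c) = - 1"
    by (auto simp: trig_character_axis exp_minus simp flip: of_real_mult)
  then have "(\<integral>x. trig_character n x \<partial>torus) = 0"
    using c by (intro torus_integral_zero_shift[where B = 1 and j = j and c = c])
      (auto simp: trig_character_add trig_character_2pi)
  then show ?thesis using False by simp
qed

text \<open>The frequencies are congruent to 1 modulo 3 in every coordinate, so the shift by
  \<open>2 * pi / 3\<close> in any one coordinate multiplies each of these characters by the same cube root of
  unity.\<close>

definition lac_freq :: "'m \<Rightarrow> nat \<Rightarrow> int ^ 'm" where
  "lac_freq i s = (\<chi> j. if j = i then 4 ^ s else 1)"

definition lac_term :: "'m \<Rightarrow> (nat \<Rightarrow> complex) \<Rightarrow> nat \<Rightarrow> real ^ 'm \<Rightarrow> complex" where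
  "lac_term i c s x = c s * trig_character (lac_freq i s) x"

definition lac_sum :: "'m \<Rightarrow> (nat \<Rightarrow> complex) \<Rightarrow> nat set \<Rightarrow> real ^ 'm \<Rightarrow> complex" where
  "lac_sum i c A x = (\<Sum>s\<in>A. lac_term i c s x)"

lemma lac_term_measurable [measurable]: "lac_term i c s \<in> borel_measurable borel"
  unfolding lac_term_def by measurable

lemma lac_sum_measurable [measurable]: "lac_sum i c A \<in> borel_measurable borel"
  unfolding lac_sum_def by measurable

lemma norm_lac_term: "norm (lac_term i c s x) = norm (c s)"
  by (simp add: lac_term_def norm_mult)

lemma norm_lac_sum_le: "norm (lac_sum i c A x) \<le> (\<Sum>s\<in>A. norm (c s))"
  unfolding lac_sum_def by (rule sum_norm_le) (simp add: norm_lac_term)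

lemma lac_term_period: "lac_term i c s (x + axis j (2 * pi)) = lac_term i c s x"
  by (simp add: lac_term_def trig_character_add trig_character_2pi)

lemma lac_sum_shift: "lac_sum i c A (x + y) = lac_sum i (\<lambda>s. c s * trig_character (lac_freq i s) y) A x"
  by (simp add: lac_sum_def lac_term_def trig_character_add mult_ac)

text \<open>The shift changes the phase by \<open>4 ^ (a - s) * pi\<close>, which is a multiple of
  \<open>2 * pi\<close> unless \<open>a = s\<close>.\<close>

lemma trig_lac_freq_shift:
  assumes "s \<le> a"
  shows "trig_character (lac_freq i a) (axis i (pi / 4 ^ s)) = (if a = s then - 1 else 1)"
proof (cases "a = s")
  case True
  then show ?thesis by (simp add: trig_character_axis lac_freq_def flip: of_real_mult of_real_power)
next
  case False
  then obtain d where d: "a = s + Suc d" using assms less_imp_Suc_add[of s a] by auto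
  have "(4 :: real) ^ a * (pi / 4 ^ s) = 2 * real_of_int (2 * 4 ^ d) * pi"
    by (simp add: d power_add)
  then have "trig_character (lac_freq i a) (axis i (pi / 4 ^ s)) = exp (\<i> * complex_of_real (2 * real_of_int (2 * 4 ^ d) * pi))"
    by (simp add: trig_character_axis lac_freq_def)
  also have "\<dots> = 1" unfolding exp_eq_1 by (auto intro!: exI[of _ "2 * 4 ^ d"])
  finally show ?thesis using False by simp
qed

lemma lac_term_shift_ge:
  assumes "s \<le> a"
  shows "lac_term i c a (x + axis i (pi / 4 ^ s)) = (if a = s then - lac_term i c a x else lac_term i c a x)"
  using assms by (simp add: lac_term_def trig_character_add trig_lac_freq_shift)

lemma pi_div_power4: "0 \<le> pi / 4 ^ s" "pi / 4 ^ s \<le> 2 * pi"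
proof -
  have "pi * 1 \<le> pi * (2 * 4 ^ s)"
    by (intro mult_left_mono) (auto intro: order_trans[of _ "2 * 1"])
  then show "0 \<le> pi / 4 ^ s" "pi / 4 ^ s \<le> 2 * pi" by (auto simp: field_simps)
qed

section \<open>Riesz products and orthogonality\<close>

lemma riesz_product_bound: "norm (\<Prod>s\<in>A. 1 + Re (lac_term i c s x)) \<le> (\<Prod>s\<in>A. 1 + norm (c s))"
  unfolding prod_norm[symmetric]
  by (rule prod_mono) (use abs_Re_le_cmod in \<open>auto simp: norm_lac_term[of i c _ x, symmetric] intro!: order_trans[OF abs_triangle_ineq]\<close>)

text \<open>The shift by \<open>pi / 4 ^ s\<close> changes the sign of the term of index \<open>s\<close> and leaves all later terms
  invariant.\<close>

lemma torus_integral_riesz_product: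
  assumes "finite A"
  shows "(\<integral>x. (\<Prod>s\<in>A. 1 + Re (lac_term i c s x)) \<partial>torus) = 1"
  using assms
\<comment> \<open>The indices are added in decreasing order: the new \<open>s\<close> lies below all
  of \<open>A\<close>, so the product over \<open>A\<close> is invariant under the shift that flips
  the new term.\<close>
proof (induction A rule: finite_linorder_min_induct)
  case empty
  then show ?case by (simp add: measure_torus_UNIV)
next
  case (insert s A)
  let ?P = "\<lambda>x. \<Prod>s\<in>A. 1 + Re (lac_term i c s x)"
  define B where "B = (\<Prod>s\<in>A. 1 + norm (c s))"
  have B: "norm (?P x) \<le> B" for x unfolding B_def by (rule riesz_product_bound)
  have B2: "norm (Re (lac_term i c s x) * ?P x) \<le> norm (c s) * B" for x
    unfolding norm_mult using abs_Re_le_cmod[of "lac_term i c s x"] B[of x]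
    by (intro mult_mono) (auto simp: norm_lac_term)
  have shift: "?P (x + axis i (pi / 4 ^ s)) = ?P x" for x
    using insert.hyps(2) by (intro prod.cong refl) (auto simp: less_imp_le lac_term_shift_ge)
  have 0: "(\<integral>x. Re (lac_term i c s x) * ?P x \<partial>torus) = 0"
    using B2 by (intro torus_integral_zero_shift[where B = "norm (c s) * B" and j = i and c = "pi / 4 ^ s"])
      (auto simp: lac_term_period shift lac_term_shift_ge pi_div_power4)
  have "s \<notin> A" using insert.hyps(2) by auto
  then have "(\<integral>x. (\<Prod>s\<in>insert s A. 1 + Re (lac_term i c s x)) \<partial>torus) = (\<integral>x. ?P x + Re (lac_term i c s x) * ?P x \<partial>torus)"
    using insert.hyps(1) by (simp add: algebra_simps)
  also have "\<dots> = (\<integral>x. ?P x \<partial>torus) + (\<integral>x. Re (lac_term i c s x) * ?P x \<partial>torus)"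
    using B B2 by (intro Bochner_Integration.integral_add torus_integrable_bounded) auto
  finally show ?case using insert.IH 0 by simp
qed

text \<open>Shifting by \<open>pi / 4 ^ s\<close> for the smaller index \<open>s\<close> flips one
  factor and fixes the other.\<close>

lemma torus_integral_lac_term_mult:
  assumes "s \<noteq> t"
  shows "(\<integral>x. Re (lac_term i c s x) * Re (lac_term i c t x) \<partial>torus) = 0"
  using assms
proof (induction s t rule: linorder_wlog)
  case (le s t)
  have "norm (Re (lac_term i c s x) * Re (lac_term i c t x)) \<le> norm (c s) * norm (c t)" for x
    unfolding norm_mult using abs_Re_le_cmod[of "lac_term i c s x"] abs_Re_le_cmod[of "lac_term i c t x"]
    by (intro mult_mono) (auto simp: norm_lac_term)
  then show ?case using le
    by (intro torus_integral_zero_shift[where B = "norm (c s) * norm (c t)" and j = i and c = "pi / 4 ^ s"])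
      (auto simp: lac_term_period lac_term_shift_ge pi_div_power4)
next
  case (sym s t)
  then show ?case by (simp add: mult.commute)
qed

text \<open>A quarter-period shift multiplies the term by \<open>\<i>\<close>, which exchanges
  cosine and sine up to sign. The two squares have the same mean and add up to the constant
  \<open>(norm (c s))\<^sup>2\<close>.\<close>

lemma torus_integral_lac_term_square:
  "(\<integral>x. (Re (lac_term i c s x))\<^sup>2 \<partial>torus) = (norm (c s))\<^sup>2 / 2"
proof -
  define y where "y = (axis i (pi / 4 ^ s / 2) :: real ^ 'a)"
  have y: "lac_term i c s (x + y) = \<i> * lac_term i c s x" for x
    using cis_pi_half
    by (simp add: lac_term_def trig_character_add y_def trig_character_axis lac_freq_def cis_conv_exp)
  have sq: "(Re (lac_term i c s x))\<^sup>2 + (Re (lac_term i c s (x + y)))\<^sup>2 = (norm (c s))\<^sup>2" for x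
    unfolding y norm_lac_term[of i c s x, symmetric] cmod_power2 by simp
  have bd: "norm ((Re (lac_term i c s x))\<^sup>2) \<le> (norm (c s))\<^sup>2" for x
    unfolding norm_lac_term[of i c s x, symmetric] cmod_power2 by simp
  have "(\<integral>x. (Re (lac_term i c s (x + y)))\<^sup>2 \<partial>torus) = (\<integral>x. (Re (lac_term i c s x))\<^sup>2 \<partial>torus)"
    unfolding y_def
  proof (rule torus_integral_shift[where F = "\<lambda>x. (Re (lac_term i c s x))\<^sup>2"])
    show "0 \<le> pi / 4 ^ s / 2" by simp
    show "pi / 4 ^ s / 2 \<le> 2 * pi"
      by (rule order_trans[OF _ pi_div_power4(2)[of s]]) (simp add: field_simps)
  qed (use bd in \<open>auto simp: lac_term_period\<close>)
  moreover have "(\<integral>x. (Re (lac_term i c s x))\<^sup>2 \<partial>torus) + (\<integral>x. (Re (lac_term i c s (x + y)))\<^sup>2 \<partial>torus) = (norm (c s))\<^sup>2"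
    using bd by (subst Bochner_Integration.integral_add[symmetric])
       (auto intro!: torus_integrable_bounded simp: sq measure_torus_UNIV)
  ultimately show ?thesis by simp
qed

lemma Re_lac_sum_bound: "norm (Re (lac_sum i c A x)) \<le> (\<Sum>s\<in>A. norm (c s))"
  using abs_Re_le_cmod[of "lac_sum i c A x"] norm_lac_sum_le[of i c A x] by simp

lemma torus_integral_lac_sum_square:
  assumes "finite A"
  shows "(\<integral>x. (Re (lac_sum i c A x))\<^sup>2 \<partial>torus) = (\<Sum>s\<in>A. (norm (c s))\<^sup>2) / 2"
proof -
  have int: "integrable torus (\<lambda>x. Re (lac_term i c s x) * Re (lac_term i c t x))" for s t
  proof (rule torus_integrable_bounded)
    show "norm (Re (lac_term i c s x) * Re (lac_term i c t x)) \<le> norm (c s) * norm (c t)" for x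
      unfolding norm_mult using abs_Re_le_cmod[of "lac_term i c s x"] abs_Re_le_cmod[of "lac_term i c t x"]
      by (intro mult_mono) (auto simp: norm_lac_term)
  qed measurable
  have "(\<integral>x. (Re (lac_sum i c A x))\<^sup>2 \<partial>torus)
      = (\<integral>x. (\<Sum>s\<in>A. \<Sum>t\<in>A. Re (lac_term i c s x) * Re (lac_term i c t x)) \<partial>torus)"
    by (simp add: lac_sum_def power2_eq_square sum_product)
  also have "\<dots> = (\<Sum>s\<in>A. \<Sum>t\<in>A. (\<integral>x. Re (lac_term i c s x) * Re (lac_term i c t x) \<partial>torus))"
    by (simp add: int)
  also have "\<dots> = (\<Sum>s\<in>A. \<Sum>t\<in>A. if t = s then (norm (c s))\<^sup>2 / 2 else 0)"
    using torus_integral_lac_term_square[of i c]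
    by (intro sum.cong refl) (auto simp: power2_eq_square torus_integral_lac_term_mult)
  also have "\<dots> = (\<Sum>s\<in>A. (norm (c s))\<^sup>2) / 2"
    using assms by (simp add: sum_divide_distrib)
  finally show ?thesis .
qed

subsection \<open>Moments of lacunary sums\<close>

lemma power_le_fact_exp:
  fixes y :: real
  assumes "0 \<le> y"
  shows "y ^ n \<le> fact n * exp y"
proof -
  have "y ^ n /\<^sub>R fact n \<le> exp y"
    using sum_le_suminf[OF sums_summable[OF exp_converges[of y]], of "{n}"] assms
    by (simp add: exp_def)
  then show ?thesis by (simp add: field_simps)
qed

lemma even_power_le_exp:
  fixes y :: real
  shows "y ^ (2 * q) \<le> fact (2 * q) * (exp y + exp (- y))"
proof -
  have "y ^ (2 * q) = \<bar>y\<bar> ^ (2 * q)" by (simp add: power_even_abs)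
  also have "\<dots> \<le> fact (2 * q) * exp \<bar>y\<bar>" by (rule power_le_fact_exp) simp
  also have "\<dots> \<le> fact (2 * q) * (exp y + exp (- y))"
    by (intro mult_left_mono) (auto simp: abs_if)
  finally show ?thesis .
qed

text \<open>After taking logarithms this is the quadratic lower bound
  \<open>u - 2 * u\<^sup>2 \<le> ln (1 + u)\<close>.\<close>

lemma exp_le_one_add_mult_exp:
  fixes u :: real
  assumes "\<bar>u\<bar> \<le> 1 / 2"
  shows "exp u \<le> (1 + u) * exp (2 * u\<^sup>2)"
proof -
  have "1 + u > 0" using assms by linarith
  moreover have "u \<le> ln (1 + u) + 2 * u\<^sup>2"
    using abs_ln_one_plus_x_minus_x_bound[OF assms] by linarith
  then have "exp u \<le> exp (ln (1 + u) + 2 * u\<^sup>2)" by simp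
  ultimately show ?thesis by (simp add: exp_add)
qed

text \<open>Factor by factor, the exponential is at most the Riesz product times a constant, and the
  Riesz product has mean 1. The bound 1/2 on the coefficients keeps all factors positive.\<close>

lemma torus_integral_exp_lac_sum:
  assumes "finite A" and c: "\<And>s. s \<in> A \<Longrightarrow> norm (c s) \<le> 1 / 2"
  shows "(\<integral>x. exp (Re (lac_sum i c A x)) \<partial>torus) \<le> exp (2 * (\<Sum>s\<in>A. (norm (c s))\<^sup>2))"
proof -
  let ?P = "\<lambda>x. \<Prod>s\<in>A. 1 + Re (lac_term i c s x)"
  let ?E = "exp (2 * (\<Sum>s\<in>A. (norm (c s))\<^sup>2))"
  have le: "exp (Re (lac_sum i c A x)) \<le> ?P x * ?E" for x
  proof -
    have "exp (Re (lac_sum i c A x)) = (\<Prod>s\<in>A. exp (Re (lac_term i c s x)))"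
      by (simp add: lac_sum_def exp_sum assms)
    also have "\<dots> \<le> (\<Prod>s\<in>A. (1 + Re (lac_term i c s x)) * exp (2 * (norm (c s))\<^sup>2))"
    proof (rule prod_mono, safe)
      fix s assume s: "s \<in> A"
      define u where "u = Re (lac_term i c s x)"
      have u: "\<bar>u\<bar> \<le> norm (c s)"
        using abs_Re_le_cmod[of "lac_term i c s x"] by (simp add: u_def norm_lac_term)
      then have "u\<^sup>2 \<le> (norm (c s))\<^sup>2"
        by (metis abs_ge_zero power2_abs power_mono)
      moreover have "0 \<le> 1 + u" using u c[OF s] by linarith
      moreover have "exp u \<le> (1 + u) * exp (2 * u\<^sup>2)"
        using u c[OF s] by (intro exp_le_one_add_mult_exp) linarith
      ultimately show "exp (Re (lac_term i c s x)) \<le> (1 + Re (lac_term i c s x)) * exp (2 * (norm (c s))\<^sup>2)"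
        unfolding u_def[symmetric] by (meson dual_order.trans exp_le_cancel_iff mult_left_mono zero_le_numeral)
    qed auto
    also have "\<dots> = ?P x * ?E"
      by (simp add: prod.distrib exp_sum assms sum_distrib_left)
    finally show ?thesis .
  qed
  have "(\<integral>x. exp (Re (lac_sum i c A x)) \<partial>torus) \<le> (\<integral>x. ?P x * ?E \<partial>torus)"
  proof (rule integral_mono[OF torus_integrable_bounded torus_integrable_bounded le])
    show "norm (exp (Re (lac_sum i c A x))) \<le> exp (\<Sum>s\<in>A. norm (c s))" for x
      using Re_lac_sum_bound[of i c A x] by simp
    show "norm (?P x * ?E) \<le> (\<Prod>s\<in>A. 1 + norm (c s)) * ?E" for x
      unfolding norm_mult by (intro mult_mono riesz_product_bound) (auto intro: prod_nonneg)
  qed measurable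
  also have "\<dots> = ?E"
    by (simp add: torus_integral_riesz_product assms)
  finally show ?thesis .
qed

text \<open>The factorial comes from comparing a power with the exponential function,
  \<open>2 * exp (1 / 2)\<close> bounds the exponential moments for the two signs together, and
  \<open>4 ^ q\<close> undoes the scaling by \<open>2 * \<sigma>\<close> in the next proof.\<close>

definition lac_moment_const :: "nat \<Rightarrow> real" where
  "lac_moment_const q = fact (2 * q) * (2 * exp (1 / 2)) * 4 ^ q"

lemma lac_moment_const_pos: "lac_moment_const q > 0"
  by (simp add: lac_moment_const_def)

text \<open>A Khinchine-type inequality. The sum is divided by twice the l2 norm of its
  coefficients, and the even power is then dominated by \<open>exp y + exp (- y)\<close>, whose mean
  is controlled by Riesz products.\<close>

lemma torus_integral_lac_sum_power:
  assumes A: "finite A" and q: "0 < q"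
  shows "(\<integral>x. (Re (lac_sum i c A x)) ^ (2 * q) \<partial>torus) \<le> lac_moment_const q * (\<Sum>s\<in>A. (norm (c s))\<^sup>2) ^ q"
proof (cases "(\<Sum>s\<in>A. (norm (c s))\<^sup>2) = 0")
  case True
  then have "c s = 0" if "s \<in> A" for s
    using that A by (auto simp: sum_nonneg_eq_0_iff)
  then have "lac_sum i c A x = 0" for x by (auto simp: lac_sum_def lac_term_def)
  then show ?thesis using q by (simp add: True zero_power)
next
  case False
  define \<sigma> where "\<sigma> = sqrt (\<Sum>s\<in>A. (norm (c s))\<^sup>2)"
  have \<sigma>: "\<sigma> > 0" "\<sigma>\<^sup>2 = (\<Sum>s\<in>A. (norm (c s))\<^sup>2)"
    using False by (auto simp: \<sigma>_def sum_nonneg less_le)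
  \<comment> \<open>Used with \<open>r = 1\<close> and \<open>r = - 1\<close>. Each scaled
    coefficient is at most 1/2 in modulus and their squares add up to 1/4.\<close>
  define d where "d r s = complex_of_real (r / (2 * \<sigma>)) * c s" for r s
  have d: "Re (lac_sum i (d r) A x) = r / (2 * \<sigma>) * Re (lac_sum i c A x)" for r x
    by (simp add: lac_sum_def lac_term_def d_def sum_distrib_left mult.assoc)
  have exp_le: "(\<integral>x. exp (Re (lac_sum i (d r) A x)) \<partial>torus) \<le> exp (1 / 2)" if r: "\<bar>r\<bar> = 1" for r
  proof -
    have n: "norm (d r s) = norm (c s) / (2 * \<sigma>)" for s
      using r \<sigma> by (simp add: d_def norm_mult norm_divide)
    have "norm (c s) \<le> \<sigma>" if "s \<in> A" for s
      unfolding \<sigma>_def using A that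
      by (intro real_le_rsqrt member_le_sum) auto
    then have "(\<integral>x. exp (Re (lac_sum i (d r) A x)) \<partial>torus) \<le> exp (2 * (\<Sum>s\<in>A. (norm (d r s))\<^sup>2))"
      using \<sigma> A by (intro torus_integral_exp_lac_sum) (auto simp: n field_simps)
    also have "(\<Sum>s\<in>A. (norm (d r s))\<^sup>2) = \<sigma>\<^sup>2 / (2 * \<sigma>)\<^sup>2"
      by (simp add: n power_divide \<sigma>(2) flip: sum_divide_distrib)
    also have "\<dots> = 1 / 4" using \<sigma>(1) by (simp add: power_mult_distrib)
    finally show ?thesis by simp
  qed
  have int: "integrable torus (\<lambda>x. exp (Re (lac_sum i (d r) A x)))" for r
    using Re_lac_sum_bound[of i "d r" A]
    by (intro torus_integrable_bounded[where B = "exp (\<Sum>s\<in>A. norm (d r s))"]) (auto simp: abs_le_iff)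
  have le: "(Re (lac_sum i c A x)) ^ (2 * q) \<le> (2 * \<sigma>) ^ (2 * q) * (fact (2 * q) *
      (exp (Re (lac_sum i (d 1) A x)) + exp (Re (lac_sum i (d (- 1)) A x))))" for x
  proof -
    let ?y = "Re (lac_sum i c A x)"
    have "?y ^ (2 * q) = (2 * \<sigma>) ^ (2 * q) * (?y / (2 * \<sigma>)) ^ (2 * q)"
      using \<sigma> by (simp add: power_divide)
    also have "\<dots> \<le> (2 * \<sigma>) ^ (2 * q) * (fact (2 * q) * (exp (?y / (2 * \<sigma>)) + exp (- (?y / (2 * \<sigma>)))))"
      using \<sigma> by (intro mult_left_mono even_power_le_exp) auto
    finally show ?thesis by (simp add: d)
  qed
  have "(\<integral>x. (Re (lac_sum i c A x)) ^ (2 * q) \<partial>torus) \<le> (\<integral>x. (2 * \<sigma>) ^ (2 * q) * (fact (2 * q) *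
      (exp (Re (lac_sum i (d 1) A x)) + exp (Re (lac_sum i (d (- 1)) A x)))) \<partial>torus)"
    using Re_lac_sum_bound[of i c A]
    by (intro integral_mono le torus_integrable_bounded[where B = "(\<Sum>s\<in>A. norm (c s)) ^ (2 * q)"]
          integrable_mult_right Bochner_Integration.integrable_add int)
      (auto simp: power_abs intro!: power_mono)
  also have "\<dots> = (2 * \<sigma>) ^ (2 * q) * (fact (2 * q) *
      ((\<integral>x. exp (Re (lac_sum i (d 1) A x)) \<partial>torus) + (\<integral>x. exp (Re (lac_sum i (d (- 1)) A x)) \<partial>torus)))"
    by (simp add: Bochner_Integration.integral_add int)
  also have "\<dots> \<le> (2 * \<sigma>) ^ (2 * q) * (fact (2 * q) * (exp (1 / 2) + exp (1 / 2)))"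
    using \<sigma> by (intro mult_left_mono add_mono exp_le) auto
  also have "\<dots> = lac_moment_const q * (\<sigma>\<^sup>2) ^ q"
    by (simp add: lac_moment_const_def power_mult_distrib power_mult)
  finally show ?thesis by (simp add: \<sigma>)
qed

definition lac_prob_const :: real where
  "lac_prob_const = 1 / (16 * lac_moment_const 2)"

lemma lac_prob_const_pos: "lac_prob_const > 0"
  by (simp add: lac_prob_const_def lac_moment_const_pos)

text \<open>The Paley--Zygmund inequality: the second and the fourth moment of a lacunary sum are
  comparable.\<close>

lemma measure_lac_sum_gt:
  assumes A: "finite A" and y: "0 < y" "4 * y\<^sup>2 \<le> (\<Sum>s\<in>A. (norm (c s))\<^sup>2)"
  shows "lac_prob_const \<le> measure torus {x. y < \<bar>Re (lac_sum i c A x)\<bar>}"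
proof -
  let ?S = "\<lambda>x. Re (lac_sum i c A x)"
  let ?A = "{x. y < \<bar>?S x\<bar>}"
  define V where "V = (\<Sum>s\<in>A. (norm (c s))\<^sup>2)"
  define C where "C = lac_moment_const 2"
  \<comment> \<open>Chosen so that the fourth-moment term
    \<open>\<delta> / 2 * (C * V\<^sup>2)\<close> equals \<open>V / 8\<close>. Of the second moment
    \<open>V / 2\<close>, at least \<open>V / 8\<close> is then left to be carried by
    \<open>?A\<close>.\<close>
  define \<delta> where "\<delta> = 1 / (4 * C * V)"
  have C: "C > 0" unfolding C_def by (rule lac_moment_const_pos)
  have "0 < y\<^sup>2" using y by simp
  then have V: "V > 0" "4 * y\<^sup>2 \<le> V" using y unfolding V_def by linarith+
  have \<delta>: "\<delta> > 0" using C V by (simp add: \<delta>_def)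
  have meas [measurable]: "?A \<in> sets torus" by simp
  \<comment> \<open>On \<open>?A\<close> this is Young's inequality with parameter
    \<open>\<delta>\<close>, in place of the usual Cauchy-Schwarz step. Off \<open>?A\<close> the
    square is at most \<open>y\<^sup>2\<close>, hence at most \<open>V / 4\<close>.\<close>
  have le: "(?S x)\<^sup>2 \<le> V / 4 + (\<delta> / 2 * (?S x) ^ 4 + 1 / (2 * \<delta>) * indicator ?A x)" for x
  proof (cases "x \<in> ?A")
    case True
    have "0 \<le> (\<delta> * (?S x)\<^sup>2 - 1)\<^sup>2" by simp
    then have "2 * \<delta> * (?S x)\<^sup>2 \<le> \<delta> * (\<delta> * (?S x) ^ 4) + 1"
      by (simp add: power2_eq_square power4_eq_xxxx algebra_simps)
    then have "(?S x)\<^sup>2 \<le> (\<delta> * (\<delta> * (?S x) ^ 4) + 1) / (2 * \<delta>)"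
      using \<delta> by (simp add: field_simps)
    also have "\<dots> = \<delta> / 2 * (?S x) ^ 4 + 1 / (2 * \<delta>)" using \<delta> by (simp add: field_simps)
    finally show ?thesis using True V by simp
  next
    case False
    then have "\<bar>?S x\<bar>\<^sup>2 \<le> y\<^sup>2" by (intro power_mono) auto
    moreover have "0 \<le> \<delta> / 2 * (?S x) ^ 4" using \<delta> by simp
    ultimately show ?thesis using False V by simp
  qed
  have int: "integrable torus (\<lambda>x. (?S x) ^ n)" for n
    using Re_lac_sum_bound[of i c A]
    by (intro torus_integrable_bounded[where B = "(\<Sum>s\<in>A. norm (c s)) ^ n"])
      (auto simp: power_abs intro!: power_mono)
  have intA: "integrable torus (indicator ?A :: _ \<Rightarrow> real)"
    using meas by (intro integrable_real_indicator) (auto simp: torus.emeasure_finite less_top[symmetric])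
  have "V / 2 = (\<integral>x. (?S x)\<^sup>2 \<partial>torus)"
    using torus_integral_lac_sum_square[OF A, where i = i] by (simp add: V_def)
  also have "\<dots> \<le> (\<integral>x. V / 4 + (\<delta> / 2 * (?S x) ^ 4 + 1 / (2 * \<delta>) * indicator ?A x) \<partial>torus)"
    by (intro integral_mono le int Bochner_Integration.integrable_add integrable_mult_right intA) simp
  also have "\<dots> = V / 4 + (\<delta> / 2 * (\<integral>x. (?S x) ^ 4 \<partial>torus) + 1 / (2 * \<delta>) * measure torus ?A)"
    using int[of 4] intA by (simp add: measure_torus_UNIV)
  also have "\<dots> \<le> V / 4 + (\<delta> / 2 * (C * V\<^sup>2) + 1 / (2 * \<delta>) * measure torus ?A)"
    using torus_integral_lac_sum_power[OF A, of 2 i c] \<delta>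
    by (intro add_mono mult_left_mono) (auto simp: C_def V_def)
  also have "\<dots> = V / 4 + V / 8 + 2 * C * V * measure torus ?A"
    using C V by (simp add: \<delta>_def field_simps power2_eq_square)
  finally have "V * (1 / 8) \<le> V * (2 * C * measure torus ?A)" by (simp add: algebra_simps)
  then have "1 / 8 \<le> 2 * C * measure torus ?A" using V by (simp only: mult_le_cancel_left_pos)
  then show ?thesis using C by (simp add: lac_prob_const_def C_def[symmetric] field_simps)
qed

text \<open>The L1 norm is bounded by second moments through
  \<open>\<bar>u\<bar> \<le> u\<^sup>2 / (2 * \<eta>) + \<eta> / 2\<close>, applied to real and
  imaginary parts. Multiplying the coefficients by \<open>- \<i>\<close> turns the imaginary part
  into the real part of a lacunary sum. The positive \<open>\<eta>\<close> avoids dividing by an l2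
  norm that may vanish.\<close>

lemma torus_integral_norm_lac_sum:
  assumes A: "finite A" and \<eta>: "0 < \<eta>" "(\<Sum>s\<in>A. (norm (c s))\<^sup>2) \<le> \<eta>\<^sup>2"
  shows "(\<integral>x. norm (lac_sum i c A x) \<partial>torus) \<le> 2 * \<eta>"
proof -
  define d where "d s = - \<i> * c s" for s
  have Im: "Im (lac_sum i c A x) = Re (lac_sum i d A x)" for x
    by (simp add: lac_sum_def lac_term_def d_def add.commute)
  have dn: "norm (d s) = norm (c s)" for s by (simp add: d_def norm_mult)
  let ?V = "\<Sum>s\<in>A. (norm (c s))\<^sup>2"
  have int: "integrable torus (\<lambda>x. (Re (lac_sum i e A x))\<^sup>2 / (2 * \<eta>))" for e
    using Re_lac_sum_bound[of i e A]
    by (intro Bochner_Integration.integrable_divide torus_integrable_bounded[where B = "(\<Sum>s\<in>A. norm (e s))\<^sup>2"])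
      (auto simp: power2_le_iff_abs_le sum_nonneg)
  have abs_le: "\<bar>u\<bar> \<le> u\<^sup>2 / (2 * \<eta>) + \<eta> / 2" for u
  proof -
    have "0 \<le> (\<bar>u\<bar> - \<eta>)\<^sup>2" by simp
    then have "2 * \<eta> * \<bar>u\<bar> \<le> u\<^sup>2 + \<eta>\<^sup>2" by (simp add: power2_diff mult_ac)
    then show ?thesis using \<eta> by (simp add: field_simps power2_eq_square)
  qed
  have le: "norm (lac_sum i c A x) \<le> (Re (lac_sum i c A x))\<^sup>2 / (2 * \<eta>) + (Re (lac_sum i d A x))\<^sup>2 / (2 * \<eta>) + \<eta>" for x
    using cmod_le[of "lac_sum i c A x"] abs_le[of "Re (lac_sum i c A x)"] abs_le[of "Im (lac_sum i c A x)"]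
    by (simp add: Im)
  have "(\<integral>x. norm (lac_sum i c A x) \<partial>torus) \<le>
     (\<integral>x. (Re (lac_sum i c A x))\<^sup>2 / (2 * \<eta>) + (Re (lac_sum i d A x))\<^sup>2 / (2 * \<eta>) + \<eta> \<partial>torus)"
    by (intro integral_mono le int Bochner_Integration.integrable_add)
      (auto intro!: torus_integrable_bounded[where B = "\<Sum>s\<in>A. norm (c s)"] norm_lac_sum_le)
  also have "\<dots> = (?V / 2) / (2 * \<eta>) + (?V / 2) / (2 * \<eta>) + \<eta>"
    using int by (simp add: torus_integral_lac_sum_square A dn measure_torus_UNIV)
  also have "\<dots> = ?V / (2 * \<eta>) + \<eta>" using \<eta> by (simp add: field_simps)
  also have "\<dots> \<le> \<eta>\<^sup>2 / (2 * \<eta>) + \<eta>" using \<eta> by (intro add_mono divide_right_mono) auto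
  also have "\<dots> \<le> 2 * \<eta>" using \<eta> by (simp add: power2_eq_square)
  finally show ?thesis .
qed

subsection \<open>Lacunary series\<close>

text \<open>Comparison through a continuous function between the indicators of \<open>y < \<bar>u\<bar>\<close> and of
  \<open>y / 2 < \<bar>u\<bar>\<close>.\<close>

lemma (in finite_measure) tail_limit:
  fixes S :: "nat \<Rightarrow> 'a \<Rightarrow> real"
  assumes [measurable]: "\<And>k. S k \<in> borel_measurable M" "g \<in> borel_measurable M"
    and lim: "AE x in M. (\<lambda>k. S k x) \<longlonglongrightarrow> g x" and y: "0 < y"
  shows "(\<And>k. K \<le> k \<Longrightarrow> c \<le> measure M {x \<in> space M. y < \<bar>S k x\<bar>}) \<Longrightarrow> c \<le> measure M {x \<in> space M. y / 2 < \<bar>g x\<bar>}"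
    and "(\<And>k. K \<le> k \<Longrightarrow> measure M {x \<in> space M. y / 2 < \<bar>S k x\<bar>} \<le> c) \<Longrightarrow> measure M {x \<in> space M. y < \<bar>g x\<bar>} \<le> c"
proof -
  define \<phi> where "\<phi> u = min 1 (max 0 (2 * \<bar>u\<bar> / y - 1))" for u :: real
  have \<phi>_meas [measurable]: "\<phi> \<in> borel_measurable borel" unfolding \<phi>_def by measurable
  have cont: "isCont \<phi> u" for u unfolding \<phi>_def using y by (intro continuous_intros) auto
  have bd: "norm (\<phi> u) \<le> 1" for u by (simp add: \<phi>_def)
  have conv: "(\<lambda>k. \<integral>x. \<phi> (S k x) \<partial>M) \<longlonglongrightarrow> (\<integral>x. \<phi> (g x) \<partial>M)"
  proof (rule integral_dominated_convergence[where w = "\<lambda>_. 1"])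
    show "AE x in M. (\<lambda>k. \<phi> (S k x)) \<longlonglongrightarrow> \<phi> (g x)"
      using lim by eventually_elim (rule isCont_tendsto_compose[OF cont])
  qed (use bd in auto)
  have int: "integrable M (\<lambda>x. \<phi> (h x))" if [measurable]: "h \<in> borel_measurable M" for h
    using bd by (intro integrable_const_bound[of _ 1]) auto
  have lo: "measure M {x \<in> space M. y < \<bar>h x\<bar>} \<le> (\<integral>x. \<phi> (h x) \<partial>M)" if [measurable]: "h \<in> borel_measurable M" for h
  proof -
    have "measure M {x \<in> space M. y < \<bar>h x\<bar>} = (\<integral>x. indicator {x \<in> space M. y < \<bar>h x\<bar>} x \<partial>M)"
      by (simp add: Int_absorb1)
    also have "\<dots> \<le> (\<integral>x. \<phi> (h x) \<partial>M)"
      using y by (intro integral_mono int integrable_real_indicator that)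
        (auto simp: \<phi>_def indicator_def field_simps emeasure_finite less_top[symmetric])
    finally show ?thesis .
  qed
  have hi: "(\<integral>x. \<phi> (h x) \<partial>M) \<le> measure M {x \<in> space M. y / 2 < \<bar>h x\<bar>}" if [measurable]: "h \<in> borel_measurable M" for h
  proof -
    have "(\<integral>x. \<phi> (h x) \<partial>M) \<le> (\<integral>x. indicator {x \<in> space M. y / 2 < \<bar>h x\<bar>} x \<partial>M)"
      using y by (intro integral_mono int integrable_real_indicator that)
        (auto simp: \<phi>_def indicator_def field_simps emeasure_finite less_top[symmetric])
    then show ?thesis by (simp add: Int_absorb1)
  qed
  show "c \<le> measure M {x \<in> space M. y / 2 < \<bar>g x\<bar>}"
    if c: "\<And>k. K \<le> k \<Longrightarrow> c \<le> measure M {x \<in> space M. y < \<bar>S k x\<bar>}"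
  proof -
    have "c \<le> (\<integral>x. \<phi> (g x) \<partial>M)"
      using c lo[of "S _"] by (intro LIMSEQ_le_const[OF conv] exI[of _ K]) (auto intro: order_trans)
    then show ?thesis using hi[of g] by simp
  qed
  show "measure M {x \<in> space M. y < \<bar>g x\<bar>} \<le> c"
    if c: "\<And>k. K \<le> k \<Longrightarrow> measure M {x \<in> space M. y / 2 < \<bar>S k x\<bar>} \<le> c"
  proof -
    have "(\<integral>x. \<phi> (g x) \<partial>M) \<le> c"
      using c hi[of "S _"] by (intro LIMSEQ_le_const2[OF conv] exI[of _ K]) (auto intro: order_trans)
    then show ?thesis using lo[of g] by simp
  qed
qed

lemma lac_sum_telescope:
  assumes "\<And>k. N k \<le> N (Suc k)"
  shows "lac_sum i c {..<N k} x = lac_sum i c {..<N 0} x + (\<Sum>l<k. lac_sum i c {N l..<N (Suc l)} x)"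
proof (induction k)
  case (Suc k)
  have "lac_sum i c {..<N (Suc k)} x = lac_sum i c {..<N k} x + lac_sum i c {N k..<N (Suc k)} x"
    unfolding lac_sum_def using assms[of k]
    by (subst sum.union_disjoint[symmetric]) (auto intro!: sum.cong)
  then show ?case using Suc by simp
qed simp

text \<open>The L1 norms of the blocks between consecutive \<open>N k\<close> decay geometrically,
  so the sum of the absolute values of the blocks is integrable and finite almost everywhere. It
  gives absolute convergence of the telescoped series and, with the initial partial sum, an
  integrable majorant.\<close>

lemma lac_sum_dominated:
  assumes N: "\<And>k. N k \<le> N (Suc k)" and B: "0 < B"
    and small: "\<And>k. (\<Sum>s\<in>{N k..<N (Suc k)}. (norm (c s))\<^sup>2) \<le> (B * (1 / 2) ^ k)\<^sup>2"
  shows "AE x in torus. convergent (\<lambda>k. lac_sum i c {..<N k} x)"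
    and "\<exists>D. integrable torus D \<and> (AE x in torus. \<forall>k. norm (lac_sum i c {..<N k} x) \<le> D x)"
proof -
  define u where "u k x = norm (lac_sum i c {N k..<N (Suc k)} x)" for k x
  have [measurable]: "u k \<in> borel_measurable borel" for k unfolding u_def by measurable
  have int: "integrable torus (u k)" for k
    unfolding u_def using norm_lac_sum_le[of i c]
    by (intro torus_integrable_bounded[where B = "\<Sum>s\<in>{N k..<N (Suc k)}. norm (c s)"]) auto
  have le: "(\<integral>x. u k x \<partial>torus) \<le> 2 * B * (1 / 2) ^ k" for k
    unfolding u_def using torus_integral_norm_lac_sum[of "{N k..<N (Suc k)}" "B * (1 / 2) ^ k" c i] B small[of k] by (simp add: mult.assoc)
  have geo: "summable (\<lambda>k. 2 * B * (1 / 2 :: real) ^ k)"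
    by (intro summable_mult summable_geometric) simp
  have nn: "0 \<le> (\<integral>x. u k x \<partial>torus)" for k by (intro Bochner_Integration.integral_nonneg) (simp add: u_def)
  have sum_int: "summable (\<lambda>k. \<integral>x. u k x \<partial>torus)"
    by (rule summable_comparison_test'[OF geo, of 0]) (use le nn in auto)
  have "(\<integral>\<^sup>+x. (\<Sum>k. ennreal (u k x)) \<partial>torus) = (\<Sum>k. \<integral>\<^sup>+x. ennreal (u k x) \<partial>torus)"
    by (rule nn_integral_suminf) measurable
  also have "\<dots> = (\<Sum>k. ennreal (\<integral>x. u k x \<partial>torus))"
    by (intro suminf_cong nn_integral_eq_integral int) (simp add: u_def)
  also have "\<dots> < \<infinity>"
    using suminf_ennreal2[OF nn sum_int] by simp
  finally have "AE x in torus. (\<Sum>k. ennreal (u k x)) \<noteq> \<infinity>"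
    by (intro nn_integral_PInf_AE) auto
  then have summ: "AE x in torus. summable (\<lambda>k. u k x)"
    by eventually_elim (intro summable_suminf_not_top, auto simp: u_def)
  show "AE x in torus. convergent (\<lambda>k. lac_sum i c {..<N k} x)"
    using summ
  proof eventually_elim
    case (elim x)
    then have "summable (\<lambda>l. lac_sum i c {N l..<N (Suc l)} x)"
      unfolding u_def by (rule summable_norm_cancel)
    then have "convergent (\<lambda>k. \<Sum>l<k. lac_sum i c {N l..<N (Suc l)} x)"
      by (simp add: summable_iff_convergent)
    then show ?case
      by (subst lac_sum_telescope[where N = N, OF N]) (simp add: convergent_add_const_iff)
  qed
  define D where "D x = norm (lac_sum i c {..<N 0} x) + (\<Sum>k. u k x)" for x
  have "integrable torus (\<lambda>x. \<Sum>k. u k x)"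
    using summ sum_int by (intro integrable_suminf int) (auto simp: u_def)
  moreover have "integrable torus (\<lambda>x. norm (lac_sum i c {..<N 0} x))"
    using norm_lac_sum_le[of i c "{..<N 0}"]
    by (intro torus_integrable_bounded[where B = "\<Sum>s\<in>{..<N 0}. norm (c s)"]) auto
  ultimately have "integrable torus D"
    unfolding D_def by (intro Bochner_Integration.integrable_add)
  moreover have "AE x in torus. \<forall>k. norm (lac_sum i c {..<N k} x) \<le> D x"
    using summ
  proof eventually_elim
    case (elim x)
    show ?case
    proof
      fix k
      have "norm (\<Sum>l<k. lac_sum i c {N l..<N (Suc l)} x) \<le> (\<Sum>l<k. u l x)"
        unfolding u_def by (rule norm_sum)
      also have "\<dots> \<le> (\<Sum>k. u k x)"
        using elim by (intro sum_le_suminf) (auto simp: u_def)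
      finally show "norm (lac_sum i c {..<N k} x) \<le> D x"
        unfolding D_def by (subst lac_sum_telescope[where N = N, OF N]) (meson add_left_mono norm_triangle_le)
    qed
  qed
  ultimately show "\<exists>D. integrable torus D \<and> (AE x in torus. \<forall>k. norm (lac_sum i c {..<N k} x) \<le> D x)"
    by blast
qed

text \<open>For square summable coefficients the series need only converge almost everywhere along a
  sequence \<open>N\<close> of partial sums that grows fast enough.\<close>

definition lac_limit :: "'m \<Rightarrow> (nat \<Rightarrow> complex) \<Rightarrow> (nat \<Rightarrow> nat) \<Rightarrow> real ^ 'm \<Rightarrow> complex" where
  "lac_limit i c N x = (if convergent (\<lambda>k. lac_sum i c {..<N k} x) then lim (\<lambda>k. lac_sum i c {..<N k} x) else 0)"

lemma lac_limit_measurable [measurable]: "lac_limit i c N \<in> borel_measurable borel"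
  \<comment> \<open>The Cauchy condition is a countable combination of measurable conditions, which
    makes the set of convergence measurable.\<close>
  unfolding lac_limit_def Cauchy_convergent_iff[symmetric] by measurable

lemma lac_limit_LIMSEQ:
  "convergent (\<lambda>k. lac_sum i c {..<N k} x) \<Longrightarrow> (\<lambda>k. lac_sum i c {..<N k} x) \<longlonglongrightarrow> lac_limit i c N x"
  by (simp add: lac_limit_def convergent_LIMSEQ_iff)

text \<open>The identity holds at every point: a nonzero factor preserves both convergence and
  divergence, and at points of divergence both sides are 0. The exact periodicity demanded by
  \<open>lorentz_space\<close> and the cancellation on every line rest on this.\<close>

lemma lac_limit_shift:
  assumes "\<And>k. lac_sum i c {..<N k} (x + y) = z * lac_sum i c {..<N k} x" and "z \<noteq> 0"
  shows "lac_limit i c N (x + y) = z * lac_limit i c N x"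
proof (cases "convergent (\<lambda>k. lac_sum i c {..<N k} x)")
  case True
  then have "(\<lambda>k. lac_sum i c {..<N k} (x + y)) \<longlonglongrightarrow> z * lac_limit i c N x"
    unfolding assms(1) by (intro tendsto_mult_left lac_limit_LIMSEQ)
  then show ?thesis
    by (simp add: lac_limit_def[of i c N "x + y"] limI convergentI)
next
  case False
  then show ?thesis using assms by (simp add: lac_limit_def convergent_mult_const_iff)
qed

lemma lac_limit_period: "lac_limit i c N (x + axis j (2 * pi)) = lac_limit i c N x"
  using lac_limit_shift[of i c N x "axis j (2 * pi)" 1] by (simp add: lac_sum_def lac_term_period)

lemma lac_limit_third_period:
  "lac_limit i c N (x + axis j (2 * pi / 3)) = exp (2 * of_real pi * \<i> / 3) * lac_limit i c N x"
proof (rule lac_limit_shift)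
  fix k
  have "trig_character (lac_freq i s) (axis j (2 * pi / 3) :: real ^ 'a) = exp (2 * of_real pi * \<i> / 3)" for s
  proof -
    have "\<exists>n. lac_freq i s $ j = 3 * n + 1"
    proof -
      have "4 ^ s mod (3 :: int) = 1"
        by (induction s) (simp, simp, presburger)
      then have "lac_freq i s $ j mod 3 = 1" by (simp add: lac_freq_def)
      then show ?thesis by (metis mult_div_mod_eq)
    qed
    then obtain n where n: "lac_freq i s $ j = 3 * n + 1" by blast
    show ?thesis unfolding trig_character_axis n exp_eq
      by (intro exI[of _ n]) (simp add: field_simps)
  qed
  then show "lac_sum i c {..<N k} (x + axis j (2 * pi / 3)) = exp (2 * of_real pi * \<i> / 3) * lac_sum i c {..<N k} x"
    unfolding lac_sum_def lac_term_def trig_character_add sum_distrib_left by (simp add: mult_ac)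
qed simp

subsection \<open>Lorentz norms and distribution functions\<close>

lemma ennreal_powr_mono: "x \<le> y \<Longrightarrow> 0 < a \<Longrightarrow> ennreal_powr x a \<le> ennreal_powr y a"
  by (auto simp: ennreal_powr_def less_top[symmetric] top_unique intro!: ennreal_leI powr_mono2 enn2real_mono)

lemma ennreal_powr_ennreal: "0 \<le> r \<Longrightarrow> ennreal_powr (ennreal r) a = ennreal (r powr a)"
  by (simp add: ennreal_powr_def)

lemma ennreal_powr_less_top: "x < \<infinity> \<Longrightarrow> ennreal_powr x a < \<infinity>"
  by (simp add: ennreal_powr_def)

section \<open>Rearrangements with respect to the torus measure\<close>

lemma rearrangement_torus:
  assumes [measurable]: "f \<in> borel_measurable borel"
  shows "rearrangement f t = Inf {y. 0 \<le> y \<and> measure torus {x. y < norm (f x)} \<le> t}"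
  unfolding rearrangement_def by (subst measure_torus) auto

lemma rearrangement_le:
  assumes "f \<in> borel_measurable borel" "0 \<le> y" "measure torus {x. y < norm (f x)} \<le> t"
  shows "rearrangement f t \<le> y"
  unfolding rearrangement_torus[OF assms(1)] using assms by (intro cInf_lower) (auto intro!: bdd_belowI[of _ 0])

text \<open>The level sets decrease to the empty set and the measure is finite. This makes the set
  in \<open>rearrangement\<close> nonempty, so that its infimum is meaningful.\<close>

lemma torus_tail_small:
  fixes f :: "real ^ 'm \<Rightarrow> 'b :: {real_normed_vector, second_countable_topology}"
  assumes [measurable]: "f \<in> borel_measurable borel" and t: "0 < t"
  shows "\<exists>y\<ge>0. measure torus {x. y < norm (f x)} \<le> t"
proof -
  have "(\<lambda>n. measure torus {x. real n < norm (f x)}) \<longlonglongrightarrow> measure torus (\<Inter>n. {x. real n < norm (f x)})"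
    by (rule torus.finite_Lim_measure_decseq) (auto simp: decseq_def)
  also have "(\<Inter>n. {x. real n < norm (f x)}) = {}"
  proof -
    have "\<exists>n. \<not> real n < norm (f x)" for x
      using reals_Archimedean2[of "norm (f x)"] by (meson less_imp_le not_less)
    then show ?thesis by auto
  qed
  finally have "eventually (\<lambda>n. measure torus {x. real n < norm (f x)} < t) sequentially"
    using t by (intro order_tendstoD(2)) auto
  then obtain n where "measure torus {x. real n < norm (f x)} < t"
    by (auto simp: eventually_sequentially)
  then show ?thesis by (intro exI[of _ "real n"]) auto
qed

lemma rearrangement_ge:
  fixes f :: "real ^ 'm \<Rightarrow> 'b :: {real_normed_vector, second_countable_topology}"
  assumes [measurable]: "f \<in> borel_measurable borel" and t: "0 < t" "t < measure torus {x. y < norm (f x)}"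
  shows "y \<le> rearrangement f t"
  unfolding rearrangement_torus[OF assms(1)]
proof (rule cInf_greatest)
  show "{y. 0 \<le> y \<and> measure torus {x. y < norm (f x)} \<le> t} \<noteq> {}"
    using torus_tail_small[OF assms(1) t(1)] by auto
  fix z assume "z \<in> {y. 0 \<le> y \<and> measure torus {x. y < norm (f x)} \<le> t}"
  then have z: "measure torus {x. z < norm (f x)} \<le> t" by simp
  show "y \<le> z"
  proof (rule ccontr)
    assume "\<not> y \<le> z"
    then have "measure torus {x. y < norm (f x)} \<le> measure torus {x. z < norm (f x)}"
      by (intro torus.finite_measure_mono) auto
    then show False using z t by simp
  qed
qed

lemma rearrangement_nonneg:
  fixes f :: "real ^ 'm \<Rightarrow> 'b :: {real_normed_vector, second_countable_topology}"
  assumes "f \<in> borel_measurable borel" and "0 < t"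
  shows "0 \<le> rearrangement f t"
  unfolding rearrangement_torus[OF assms(1)]
  using torus_tail_small[OF assms] by (intro cInf_greatest) auto

lemma nn_integral_powr_from_0:
  fixes \<alpha> c :: real
  assumes "0 < \<alpha>" and "0 \<le> c"
  shows "(\<integral>\<^sup>+ t\<in>{0<..<c}. ennreal (t powr (\<alpha> - 1)) \<partial>lborel) = ennreal (c powr \<alpha> / \<alpha>)"
proof -
  have "((\<lambda>t. t powr (\<alpha> - 1)) has_integral (c powr \<alpha> / \<alpha>)) {0<..<c}"
    using has_integral_powr_from_0[of "\<alpha> - 1" c] assms by (simp add: has_integral_Icc_iff_Ioo)
  moreover have "(\<lambda>t. t powr (\<alpha> - 1) * indicator {0<..<c} t) = (\<lambda>t. if t \<in> {0<..<c} then t powr (\<alpha> - 1) else 0)"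
    by (auto simp: indicator_def)
  ultimately have "((\<lambda>t. t powr (\<alpha> - 1) * indicator {0<..<c} t) has_integral (c powr \<alpha> / \<alpha>)) UNIV"
    by (simp only: has_integral_restrict_UNIV)
  then have "(\<integral>\<^sup>+ t. ennreal (t powr (\<alpha> - 1) * indicator {0<..<c} t) \<partial>lborel) = ennreal (c powr \<alpha> / \<alpha>)"
    by (intro nn_integral_has_integral_lborel) auto
  then show ?thesis by (simp add: ennreal_mult' ennreal_indicator)
qed

text \<open>The integrand is at most \<open>K powr \<tau> * t powr (\<alpha> - 1)\<close> with
  \<open>\<alpha> = \<tau> / p - \<kappa> * \<tau>\<close>, which is positive, hence integrable at
  0, exactly because \<open>\<kappa> < 1 / p\<close>.\<close>

lemma lorentz_norm_le_powr:
  fixes f :: "real ^ 'm \<Rightarrow> 'b :: {real_normed_vector, second_countable_topology}"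
  assumes f: "f \<in> borel_measurable borel" and p: "0 < p" "0 < \<tau>" and \<kappa>: "0 \<le> K" "\<kappa> < 1 / p"
    and le: "\<And>t. 0 < t \<Longrightarrow> t < 1 \<Longrightarrow> rearrangement f t \<le> K * t powr (- \<kappa>)"
  shows "lorentz_norm p \<tau> f \<le> ennreal (K * (1 / (1 - \<kappa> * p)) powr (1 / \<tau>))"
proof -
  define \<alpha> where "\<alpha> = \<tau> / p - \<kappa> * \<tau>"
  have "\<kappa> * \<tau> < 1 / p * \<tau>" using p \<kappa> by (intro mult_strict_right_mono) auto
  then have \<alpha>: "0 < \<alpha>" by (simp add: \<alpha>_def)
  have "(\<integral>\<^sup>+ t\<in>{0<..<1}. ennreal ((rearrangement f t) powr \<tau> * t powr (\<tau> / p - 1)) \<partial>lborel)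
      \<le> (\<integral>\<^sup>+ t. ennreal (K powr \<tau>) * (ennreal (t powr (\<alpha> - 1)) * indicator {0<..<1} t) \<partial>lborel)"
  proof (rule nn_integral_mono, unfold indicator_def, clarsimp)
    fix t :: real assume t: "0 < t" "t < 1"
    have "(rearrangement f t) powr \<tau> \<le> (K * t powr (- \<kappa>)) powr \<tau>"
      using t p by (intro powr_mono2 le rearrangement_nonneg f) auto
    also have "\<dots> = K powr \<tau> * t powr (- \<kappa> * \<tau>)"
      using t \<kappa> by (simp add: powr_mult powr_powr)
    finally have "(rearrangement f t) powr \<tau> * t powr (\<tau> / p - 1) \<le> K powr \<tau> * (t powr (- \<kappa> * \<tau>) * t powr (\<tau> / p - 1))"
      by (metis mult.assoc mult_right_mono powr_ge_zero)
    also have "t powr (- \<kappa> * \<tau>) * t powr (\<tau> / p - 1) = t powr (\<alpha> - 1)"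
      by (simp add: powr_add[symmetric] \<alpha>_def algebra_simps)
    finally show "ennreal ((rearrangement f t) powr \<tau> * t powr (\<tau> / p - 1)) \<le> ennreal (K powr \<tau>) * ennreal (t powr (\<alpha> - 1))"
      by (simp add: ennreal_mult''[symmetric] ennreal_leI)
  qed
  also have "\<dots> = ennreal (K powr \<tau>) * ennreal (1 / \<alpha>)"
    using nn_integral_powr_from_0[OF \<alpha>, of 1] by (subst nn_integral_cmult) auto
  finally have "ennreal (\<tau> / p) * (\<integral>\<^sup>+ t\<in>{0<..<1}. ennreal ((rearrangement f t) powr \<tau> * t powr (\<tau> / p - 1)) \<partial>lborel)
      \<le> ennreal (\<tau> / p) * (ennreal (K powr \<tau>) * ennreal (1 / \<alpha>))"
    by (rule mult_left_mono) simp
  also have "\<dots> = ennreal (K powr \<tau> * (1 / (1 - \<kappa> * p)))"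
  proof -
    have "\<tau> / p * (1 / \<alpha>) = 1 / (1 - \<kappa> * p)" using p \<alpha> by (simp add: \<alpha>_def field_simps)
    then have "\<tau> / p * (K powr \<tau> * (1 / \<alpha>)) = K powr \<tau> * (1 / (1 - \<kappa> * p))" by (metis mult.left_commute)
    then show ?thesis using \<alpha> p by (simp add: ennreal_mult''[symmetric] del: times_divide_eq_right)
  qed
  finally have "lorentz_norm p \<tau> f \<le> ennreal_powr (ennreal (K powr \<tau> * (1 / (1 - \<kappa> * p)))) (1 / \<tau>)"
    unfolding lorentz_norm_def using p by (intro ennreal_powr_mono) auto
  also have "\<dots> = ennreal (K * (1 / (1 - \<kappa> * p)) powr (1 / \<tau>))"
  proof -
    have "0 \<le> 1 / (1 - \<kappa> * p)" using p \<kappa> by (simp add: field_simps)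
    then have "(K powr \<tau> * (1 / (1 - \<kappa> * p))) powr (1 / \<tau>) = K * (1 / (1 - \<kappa> * p)) powr (1 / \<tau>)"
      using p \<kappa> by (subst powr_mult) (auto simp: powr_powr)
    then show ?thesis using \<open>0 \<le> 1 / (1 - \<kappa> * p)\<close> by (subst ennreal_powr_ennreal) (auto simp del: times_divide_eq_right)
  qed
  finally show ?thesis .
qed

text \<open>The case \<open>\<kappa> = 0\<close> of the previous estimate. The factor
  \<open>\<tau> / p\<close> in the norm makes the constant 1.\<close>

lemma lorentz_norm_le_bound:
  fixes f :: "real ^ 'm \<Rightarrow> 'b :: {real_normed_vector, second_countable_topology}"
  assumes f: "f \<in> borel_measurable borel" and p: "0 < p" "0 < \<tau>" and B: "0 \<le> B" "\<And>x. norm (f x) \<le> B"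
  shows "lorentz_norm p \<tau> f \<le> ennreal B"
proof -
  have "{x. B < norm (f x)} = {}" using B(2) by (auto simp: not_less)
  then have "rearrangement f t \<le> B" if "0 < t" for t
    using that B(1) by (intro rearrangement_le f) auto
  then show ?thesis
    using lorentz_norm_le_powr[OF f p B(1), of 0] p by simp
qed

text \<open>Solving \<open>C / y ^ n = t\<close> for \<open>y\<close> bounds the rearrangement by a
  multiple of \<open>t powr (- (1 / n))\<close>, and \<open>p < real n\<close> makes this power
  admissible.\<close>

lemma lorentz_norm_finite_tail:
  fixes f :: "real ^ 'm \<Rightarrow> 'b :: {real_normed_vector, second_countable_topology}"
  assumes f: "f \<in> borel_measurable borel" and p: "0 < p" "0 < \<tau>" and n: "p < real n" and C: "0 < C"
    and tail: "\<And>y. 0 < y \<Longrightarrow> measure torus {x. y < norm (f x)} \<le> C / y ^ n"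
  shows "lorentz_norm p \<tau> f < \<infinity>"
proof -
  have n0: "0 < n" using n p by (auto intro: gr0I)
  have "rearrangement f t \<le> C powr (1 / n) * t powr (- (1 / n))" if t: "0 < t" "t < 1" for t
  proof (rule rearrangement_le[OF f])
    let ?y = "C powr (1 / n) * t powr (- (1 / n))"
    have y: "?y > 0" using C t by simp
    have "?y ^ n = C * (1 / t)"
      using C t n0 by (simp add: power_divide powr_power powr_minus_divide)
    then have "C / ?y ^ n = t" using C t by simp
    then show "measure torus {x. ?y < norm (f x)} \<le> t" using tail[OF y] by simp
    show "0 \<le> ?y" by simp
  qed
  then have "lorentz_norm p \<tau> f \<le> ennreal (C powr (1 / n) * (1 / (1 - 1 / n * p)) powr (1 / \<tau>))"
    using p n n0 by (intro lorentz_norm_le_powr f) (auto simp: field_simps)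
  also have "\<dots> < \<infinity>" by simp
  finally show ?thesis .
qed

text \<open>The rearrangement is at least \<open>y\<close> on \<open>{0<..<c}\<close>, and this
  interval alone contributes the stated amount.\<close>

lemma lorentz_norm_ge_tail:
  fixes f :: "real ^ 'm \<Rightarrow> 'b :: {real_normed_vector, second_countable_topology}"
  assumes f: "f \<in> borel_measurable borel" and p: "0 < p" "0 < \<tau>" and c: "0 < c" and y: "0 \<le> y"
    and tail: "c \<le> measure torus {x. y < norm (f x)}"
  shows "ennreal (y * c powr (1 / p)) \<le> lorentz_norm p \<tau> f"
proof -
  have "measure torus {x. y < norm (f x)} \<le> 1"
    using torus.bounded_measure[of "{x. y < norm (f x)}"] by (simp add: measure_torus_UNIV)
  then have c1: "c \<le> 1" using tail by simp
  have "ennreal (y powr \<tau>) * ennreal (c powr (\<tau> / p) / (\<tau> / p))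
      = (\<integral>\<^sup>+ t. ennreal (y powr \<tau>) * (ennreal (t powr (\<tau> / p - 1)) * indicator {0<..<c} t) \<partial>lborel)"
    using nn_integral_powr_from_0[of "\<tau> / p" c] p c by (subst nn_integral_cmult) auto
  also have "\<dots> \<le> (\<integral>\<^sup>+ t\<in>{0<..<1}. ennreal ((rearrangement f t) powr \<tau> * t powr (\<tau> / p - 1)) \<partial>lborel)"
  proof (rule nn_integral_mono)
    fix t :: real
    show "ennreal (y powr \<tau>) * (ennreal (t powr (\<tau> / p - 1)) * indicator {0<..<c} t)
        \<le> ennreal ((rearrangement f t) powr \<tau> * t powr (\<tau> / p - 1)) * indicator {0<..<1} t"
    proof (cases "0 < t \<and> t < c")
      case True
      then have "y powr \<tau> \<le> (rearrangement f t) powr \<tau>"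
        using tail y p by (intro powr_mono2 rearrangement_ge f) auto
      then have "y powr \<tau> * t powr (\<tau> / p - 1) \<le> (rearrangement f t) powr \<tau> * t powr (\<tau> / p - 1)"
        by (intro mult_right_mono) auto
      then show ?thesis using True c1 by (simp add: ennreal_mult''[symmetric] ennreal_leI)
    qed simp
  qed
  finally have "ennreal (\<tau> / p) * (ennreal (y powr \<tau>) * ennreal (c powr (\<tau> / p) / (\<tau> / p))) \<le>
     ennreal (\<tau> / p) * (\<integral>\<^sup>+ t\<in>{0<..<1}. ennreal ((rearrangement f t) powr \<tau> * t powr (\<tau> / p - 1)) \<partial>lborel)"
    by (rule mult_left_mono) simp
  also have "ennreal (\<tau> / p) * (ennreal (y powr \<tau>) * ennreal (c powr (\<tau> / p) / (\<tau> / p))) = ennreal (y powr \<tau> * c powr (\<tau> / p))"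
  proof -
    have "\<tau> / p * (y powr \<tau> * (c powr (\<tau> / p) / (\<tau> / p))) = y powr \<tau> * c powr (\<tau> / p)"
      using p by simp
    then show ?thesis using p by (simp add: ennreal_mult''[symmetric] del: times_divide_eq_right times_divide_eq_left)
  qed
  finally have "ennreal_powr (ennreal (y powr \<tau> * c powr (\<tau> / p))) (1 / \<tau>) \<le> lorentz_norm p \<tau> f"
    unfolding lorentz_norm_def using p by (intro ennreal_powr_mono) auto
  moreover have "(y powr \<tau> * c powr (\<tau> / p)) powr (1 / \<tau>) = y * c powr (1 / p)"
    using p y by (simp add: powr_mult powr_powr)
  ultimately show ?thesis by (simp add: ennreal_powr_ennreal)
qed

subsection \<open>Mixed differences of lacunary series\<close>

text \<open>The Fourier multiplier by which the mixed difference acts on the term of index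
  \<open>s\<close>. The set \<open>J\<close> of coordinates already treated allows induction along
  the fold in \<open>mixed_difference\<close>.\<close>

definition diff_mult :: "'m \<Rightarrow> nat ^ 'm \<Rightarrow> real ^ 'm \<Rightarrow> 'm set \<Rightarrow> nat \<Rightarrow> complex" where
  "diff_mult i k h J s = (\<Prod>j\<in>J. (trig_character (lac_freq i s) (axis j (h $ j)) - 1) ^ (k $ j))"

lemma coord_difference_Re_lac_sum:
  "coord_difference h j (\<lambda>x. Re (lac_sum i c A x)) =
     (\<lambda>x. Re (lac_sum i (\<lambda>s. (trig_character (lac_freq i s) (axis j (h $ j)) - 1) * c s) A x))"
  unfolding coord_difference_def lac_sum_def lac_term_def trig_character_add
  by (simp add: sum_subtractf[symmetric] algebra_simps)

lemma funpow_coord_difference_Re_lac_sum: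
  "(coord_difference h j ^^ n) (\<lambda>x. Re (lac_sum i c A x)) =
     (\<lambda>x. Re (lac_sum i (\<lambda>s. (trig_character (lac_freq i s) (axis j (h $ j)) - 1) ^ n * c s) A x))"
  by (induction n) (simp_all add: coord_difference_Re_lac_sum mult.assoc)

lemma mixed_difference_Re_lac_sum:
  "mixed_difference k h (\<lambda>x. Re (lac_sum i c A x)) = (\<lambda>x. Re (lac_sum i (\<lambda>s. diff_mult i k h UNIV s * c s) A x))"
proof -
  interpret comp_fun_commute "\<lambda>j. coord_difference h j ^^ (k $ j)"
    by (rule comp_fun_commute_mixed_difference)
  have "Finite_Set.fold (\<lambda>j. coord_difference h j ^^ (k $ j)) (\<lambda>x. Re (lac_sum i c A x)) J =
      (\<lambda>x. Re (lac_sum i (\<lambda>s. diff_mult i k h J s * c s) A x))" if "finite J" for J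
    using that
    by induction (simp_all add: diff_mult_def funpow_coord_difference_Re_lac_sum mult.assoc)
  from this[of UNIV] show ?thesis by (simp add: mixed_difference_def)
qed

lemma mixed_difference_induct:
  assumes base: "P f" and step: "\<And>g j. P g \<Longrightarrow> P (coord_difference h j g)"
  shows "P (mixed_difference k h f)"
proof -
  interpret comp_fun_commute "\<lambda>j. coord_difference h j ^^ (k $ j)"
    by (rule comp_fun_commute_mixed_difference)
  have pow: "P ((coord_difference h j ^^ n) g)" if "P g" for g j n
    using that by (induction n) (auto intro: step)
  have "P (Finite_Set.fold (\<lambda>j. coord_difference h j ^^ (k $ j)) f J)" if "finite J" for J
    using that by induction (auto intro: base pow)
  then show ?thesis by (simp add: mixed_difference_def)
qed

lemma mixed_difference_measurable:
  assumes "f \<in> borel_measurable borel"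
  shows "mixed_difference k h f \<in> borel_measurable borel"
proof (rule mixed_difference_induct[where P = "\<lambda>f. f \<in> borel_measurable borel", OF assms])
  fix g :: "real ^ 'a \<Rightarrow> real" and j
  assume [measurable]: "g \<in> borel_measurable borel"
  show "coord_difference h j g \<in> borel_measurable borel"
    unfolding coord_difference_def by measurable
qed

text \<open>A difference at \<open>x\<close> uses values at shifted points, so convergence is
  required on a set \<open>X\<close> that is closed under the steps of \<open>h\<close>.\<close>

lemma mixed_difference_LIMSEQ:
  assumes X: "\<And>x j. x \<in> X \<Longrightarrow> x + axis j (h $ j) \<in> X"
    and lim: "\<And>x. x \<in> X \<Longrightarrow> (\<lambda>l. S l x) \<longlonglongrightarrow> g x" and x: "x \<in> X"
  shows "(\<lambda>l. mixed_difference k h (S l) x) \<longlonglongrightarrow> mixed_difference k h g x"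
proof -
  interpret comp_fun_commute "\<lambda>j. coord_difference h j ^^ (k $ j)"
    by (rule comp_fun_commute_mixed_difference)
  define conv where "conv S g \<longleftrightarrow> (\<forall>x\<in>X. (\<lambda>l. S l x) \<longlonglongrightarrow> g x)"
    for S :: "nat \<Rightarrow> real ^ 'a \<Rightarrow> real" and g
  have step: "conv (\<lambda>l. coord_difference h j (S l)) (coord_difference h j g)" if "conv S g" for S g j
    using that X unfolding conv_def coord_difference_def by (auto intro!: tendsto_diff)
  have pow: "conv (\<lambda>l. (coord_difference h j ^^ n) (S l)) ((coord_difference h j ^^ n) g)" if "conv S g" for S g j n
    using that by (induction n) (auto intro: step)
  have "conv (\<lambda>l. Finite_Set.fold (\<lambda>j. coord_difference h j ^^ (k $ j)) (S l) J)
      (Finite_Set.fold (\<lambda>j. coord_difference h j ^^ (k $ j)) g J)" if "finite J" for J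
    using that
  proof induction
    case empty
    then show ?case using lim by (simp add: conv_def)
  next
    case (insert j J)
    then show ?case by (auto intro: pow)
  qed
  from this[of UNIV] show ?thesis using x by (simp add: mixed_difference_def conv_def)
qed

text \<open>Mixed differences of partial sums are lacunary sums with multiplied coefficients, so the
  Paley-Zygmund bound applies to them. It passes to the limit with \<open>y\<close> halved. Terms
  outside \<open>A\<close> only increase the l2 norm.\<close>

lemma lorentz_norm_mixed_difference_ge:
  assumes N: "strict_mono N" and B: "0 < B"
    and small: "\<And>l. (\<Sum>s\<in>{N l..<N (Suc l)}. (norm (c s))\<^sup>2) \<le> (B * (1 / 2) ^ l)\<^sup>2"
    and p: "0 < p" "0 < \<tau>" and A: "finite A" and y: "0 < y" "4 * y\<^sup>2 \<le> (\<Sum>s\<in>A. (norm (diff_mult i k h UNIV s * c s))\<^sup>2)"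
  shows "ennreal (y / 2 * lac_prob_const powr (1 / p)) \<le> lorentz_norm p \<tau> (mixed_difference k h (\<lambda>x. Re (lac_limit i c N x)))"
proof -
  have N': "N l \<le> N (Suc l)" for l using N by (simp add: strict_mono_less_eq)
  \<comment> \<open>Lists of coordinates encode all points reachable by repeated steps. There are
    countably many, so almost every \<open>x\<close> has convergence at all of them.\<close>
  define shift where "shift js = (\<Sum>j\<leftarrow>js. axis j (h $ j))" for js :: "'a list"
  let ?g = "mixed_difference k h (\<lambda>x. Re (lac_limit i c N x))"
  let ?S = "\<lambda>l x. Re (lac_sum i (\<lambda>s. diff_mult i k h UNIV s * c s) {..<N l} x)"
  \<comment> \<open>A shift of the argument only multiplies the coefficients by numbers of modulus
    1, so the block bounds persist.\<close>
  have "AE x in torus. convergent (\<lambda>l. lac_sum i c {..<N l} (x + shift js))" for js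
    unfolding lac_sum_shift using small
    by (intro lac_sum_dominated(1)[where B = B] N' B) (simp add: norm_mult)
  then have "AE x in torus. \<forall>js. convergent (\<lambda>l. lac_sum i c {..<N l} (x + shift js))"
    by (subst AE_all_countable) blast
  then have lim: "AE x in torus. (\<lambda>l. ?S l x) \<longlonglongrightarrow> ?g x"
  proof eventually_elim
    case (elim x)
    have "(\<lambda>l. mixed_difference k h (\<lambda>x. Re (lac_sum i c {..<N l} x)) x) \<longlonglongrightarrow> ?g x"
    proof (rule mixed_difference_LIMSEQ[where X = "range (\<lambda>js. x + shift js)"])
      fix u j assume "u \<in> range (\<lambda>js. x + shift js)"
      then obtain js where "u = x + shift js" by auto
      then have "u + axis j (h $ j) = x + shift (j # js)" by (simp add: shift_def)
      then show "u + axis j (h $ j) \<in> range (\<lambda>js. x + shift js)" by blast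
    next
      fix u assume "u \<in> range (\<lambda>js. x + shift js)"
      then show "(\<lambda>l. Re (lac_sum i c {..<N l} u)) \<longlonglongrightarrow> Re (lac_limit i c N u)"
        using elim by (auto intro!: tendsto_Re lac_limit_LIMSEQ)
    next
      have "x = x + shift []" by (simp add: shift_def)
      then show "x \<in> range (\<lambda>js. x + shift js)" by blast
    qed
    then show ?case by (simp add: mixed_difference_Re_lac_sum)
  qed
  have g: "?g \<in> borel_measurable borel" by (rule mixed_difference_measurable) measurable
  obtain K where K: "A \<subseteq> {..<K}" using A finite_nat_bounded by blast
  have "lac_prob_const \<le> measure torus {x \<in> space torus. y / 2 < \<bar>?g x\<bar>}"
  proof (rule torus.tail_limit(1)[OF _ _ lim y(1), where K = K])
    fix l assume "K \<le> l"
    then have "A \<subseteq> {..<N l}" using K strict_mono_imp_increasing[OF N, of l] by auto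
    then have "(\<Sum>s\<in>A. (norm (diff_mult i k h UNIV s * c s))\<^sup>2) \<le> (\<Sum>s\<in>{..<N l}. (norm (diff_mult i k h UNIV s * c s))\<^sup>2)"
      by (intro sum_mono2) auto
    then show "lac_prob_const \<le> measure torus {x \<in> space torus. y < \<bar>?S l x\<bar>}"
      using y by simp (intro measure_lac_sum_gt, auto)
  qed (use g in simp_all)
  then show ?thesis
    using y by (intro lorentz_norm_ge_tail g p lac_prob_const_pos) auto
qed

text \<open>An even moment of order \<open>2 * q > p\<close> is bounded uniformly in the partial
  sums. Markov's inequality turns it into a power tail, which passes to the limit at the cost of the
  factor \<open>4 ^ q\<close>.\<close>

lemma lorentz_norm_lac_limit_finite:
  assumes N: "strict_mono N" and B: "0 < B"
    and small: "\<And>l. (\<Sum>s\<in>{N l..<N (Suc l)}. (norm (c s))\<^sup>2) \<le> (B * (1 / 2) ^ l)\<^sup>2"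
    and p: "0 < p" "0 < \<tau>" and summ: "summable (\<lambda>s. (norm (c s))\<^sup>2)"
  shows "lorentz_norm p \<tau> (\<lambda>x. Re (lac_limit i c N x)) < \<infinity>"
proof -
  have N': "N l \<le> N (Suc l)" for l using N by (simp add: strict_mono_less_eq)
  obtain q :: nat where q: "p < real (2 * q)" "0 < q"
  proof -
    obtain q :: nat where "p < real q" using reals_Archimedean2 by blast
    then show ?thesis using p by (intro that[of q]) (auto intro: gr0I)
  qed
  define V where "V = (\<Sum>s. (norm (c s))\<^sup>2) + 1"
  have V: "(\<Sum>s\<in>A. (norm (c s))\<^sup>2) \<le> V" if "finite A" for A
    using sum_le_suminf[OF summ that] by (auto simp: V_def)
  have "0 < V" using suminf_nonneg[OF summ] by (simp add: V_def)
  define C where "C = lac_moment_const q * V ^ q"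
  have C: "0 < C" using \<open>0 < V\<close> lac_moment_const_pos by (simp add: C_def)
  let ?S = "\<lambda>l x. Re (lac_sum i c {..<N l} x)"
  have lim: "AE x in torus. (\<lambda>l. ?S l x) \<longlonglongrightarrow> Re (lac_limit i c N x)"
    using lac_sum_dominated(1)[where i = i and c = c, OF N' B small]
    by eventually_elim (intro tendsto_Re lac_limit_LIMSEQ)
  have tail_sum: "measure torus {x \<in> space torus. y / 2 < \<bar>?S l x\<bar>} \<le> C / (y / 2) ^ (2 * q)" if y: "0 < y" for y l
  proof -
    have int: "integrable torus (\<lambda>x. (?S l x) ^ (2 * q))"
      using Re_lac_sum_bound[of i c "{..<N l}"]
      by (intro torus_integrable_bounded[where B = "(\<Sum>s\<in>{..<N l}. norm (c s)) ^ (2 * q)"])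
        (auto simp: power_abs intro!: power_mono)
    have "(y / 2) ^ (2 * q) \<le> (?S l x) ^ (2 * q)" if "y / 2 < \<bar>?S l x\<bar>" for x
    proof -
      have "(y / 2) ^ (2 * q) \<le> \<bar>?S l x\<bar> ^ (2 * q)" using that y by (intro power_mono) auto
      then show ?thesis by (simp add: power_even_abs)
    qed
    then have "measure torus {x \<in> space torus. y / 2 < \<bar>?S l x\<bar>} \<le> measure torus {x \<in> space torus. (y / 2) ^ (2 * q) \<le> (?S l x) ^ (2 * q)}"
      by (intro torus.finite_measure_mono) auto
    also have "\<dots> \<le> (\<integral>x. (?S l x) ^ (2 * q) \<partial>torus) / (y / 2) ^ (2 * q)"
      using y by (intro integral_Markov_inequality_measure[where A = "{}", OF int]) auto
    also have "\<dots> \<le> C / (y / 2) ^ (2 * q)"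
    proof (rule divide_right_mono)
      have "(\<Sum>s<N l. (norm (c s))\<^sup>2) ^ q \<le> V ^ q" by (intro power_mono V sum_nonneg) auto
      then have "lac_moment_const q * (\<Sum>s<N l. (norm (c s))\<^sup>2) ^ q \<le> C"
        unfolding C_def using lac_moment_const_pos[of q] by (intro mult_left_mono) auto
      then show "(\<integral>x. (?S l x) ^ (2 * q) \<partial>torus) \<le> C"
        using torus_integral_lac_sum_power[of "{..<N l}" q i c] q by simp
    qed (use y in simp)
    finally show ?thesis .
  qed
  show ?thesis
  proof (rule lorentz_norm_finite_tail[OF _ p q(1)])
    show "0 < C * 4 ^ q" using C by simp
    fix y :: real assume y: "0 < y"
    have "measure torus {x \<in> space torus. y < \<bar>Re (lac_limit i c N x)\<bar>} \<le> C / (y / 2) ^ (2 * q)"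
      by (rule torus.tail_limit(2)[OF _ _ lim y tail_sum[OF y]]) measurable
    also have "C / (y / 2) ^ (2 * q) = C * 4 ^ q / y ^ (2 * q)"
      by (simp add: power_divide power_mult)
    finally show "measure torus {x. y < norm (Re (lac_limit i c N x))} \<le> C * 4 ^ q / y ^ (2 * q)" by simp
  qed measurable
qed

subsection \<open>Fourier coefficients of lacunary series\<close>

lemma summable_subsequence_blocks:
  fixes f :: "nat \<Rightarrow> real"
  assumes f: "summable f" and B: "0 < B"
  shows "\<exists>N. strict_mono N \<and> (\<forall>l. (\<Sum>s\<in>{N l..<N (Suc l)}. f s) \<le> (B * (1 / 2) ^ l)\<^sup>2)"
proof -
  \<comment> \<open>The bound is required for every right endpoint \<open>m\<close>, so that
    \<open>N l\<close> can be fixed before \<open>N (Suc l)\<close> is known.\<close>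
  define P where "P l n \<longleftrightarrow> (\<forall>m. (\<Sum>s\<in>{n..<m}. f s) \<le> (B * (1 / 2) ^ l)\<^sup>2)" for l n :: nat
  have ex: "\<exists>n>n0. P l n" for l n0 :: nat
  proof -
    have "0 < (B * (1 / 2) ^ l)\<^sup>2" using B by simp
    then obtain n where n: "\<And>m n'. n \<le> m \<Longrightarrow> norm (\<Sum>s\<in>{m..<n'}. f s) < (B * (1 / 2) ^ l)\<^sup>2"
      using f unfolding summable_Cauchy by blast
    have "P l (max n (Suc n0))"
      unfolding P_def using n[of "max n (Suc n0)"] by (auto intro: order_trans[OF abs_ge_self] less_imp_le)
    then show ?thesis by (intro exI[of _ "max n (Suc n0)"]) auto
  qed
  have "\<exists>N. \<forall>l. P l (N l) \<and> N l < N (Suc l)"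
    by (rule dependent_nat_choice) (use ex in blast)+
  then obtain N where "\<And>l. P l (N l)" "\<And>l. N l < N (Suc l)" by blast
  then show ?thesis by (intro exI[of _ N]) (auto simp: P_def strict_mono_Suc_iff)
qed

section \<open>Coefficients of the limit and their dyadic blocks\<close>

lemma lac_freq_inject: "lac_freq i s = lac_freq i t \<longleftrightarrow> s = t"
  by (auto simp: lac_freq_def vec_eq_iff dest!: spec[of _ i])

lemma lac_freq_neq_uminus: "lac_freq i s \<noteq> - lac_freq i t"
proof
  assume "lac_freq i s = - lac_freq i t"
  then have "lac_freq i s $ i = (- lac_freq i t) $ i" by simp
  then have "(4 :: int) ^ s + 4 ^ t = 0" by (simp add: lac_freq_def)
  moreover have "0 < (4 :: int) ^ s + 4 ^ t" by (intro add_pos_pos) auto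
  ultimately show False by simp
qed

text \<open>Since \<open>Re z\<close> is half the sum of \<open>z\<close> and \<open>cnj z\<close>,
  each term splits into the characters of frequencies \<open>lac_freq i s\<close> and
  \<open>- lac_freq i s\<close>, which are then tested for equality with \<open>n\<close>.\<close>

lemma torus_integral_Re_lac_sum_character:
  assumes "finite A"
  shows "(\<integral>x. complex_of_real (Re (lac_sum i c A x)) * trig_character (- n) x \<partial>torus)
     = (\<Sum>s\<in>A. (if lac_freq i s = n then c s / 2 else 0) + (if - lac_freq i s = n then cnj (c s) / 2 else 0))"
proof -
  let ?T = "\<lambda>s x. c s / 2 * trig_character (lac_freq i s + - n) x + cnj (c s) / 2 * trig_character (- lac_freq i s + - n) x"
  have int: "integrable torus (\<lambda>x. trig_character m x)" for m :: "int ^ 'a"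
    by (rule torus_integrable_bounded[where B = 1]) simp_all
  have "complex_of_real (Re (lac_sum i c A x)) * trig_character (- n) x = (\<Sum>s\<in>A. ?T s x)" for x
  proof -
    have "complex_of_real (Re z) = z / 2 + cnj z / 2" for z
      by (simp add: complex_eq_iff)
    then have "complex_of_real (Re (lac_sum i c A x)) * trig_character (- n) x
        = (\<Sum>s\<in>A. (lac_term i c s x / 2 + cnj (lac_term i c s x) / 2) * trig_character (- n) x)"
      by (simp add: lac_sum_def sum_distrib_right)
    also have "\<dots> = (\<Sum>s\<in>A. ?T s x)"
      by (intro sum.cong refl)
        (simp only: lac_term_def trig_character_add_index trig_character_uminus complex_cnj_mult, simp add: algebra_simps)
    finally show ?thesis .
  qed
  then have "(\<integral>x. complex_of_real (Re (lac_sum i c A x)) * trig_character (- n) x \<partial>torus) = (\<Sum>s\<in>A. \<integral>x. ?T s x \<partial>torus)"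
    using int by (simp only: Bochner_Integration.integral_sum Bochner_Integration.integrable_add integrable_mult_right)
  also have "\<dots> = (\<Sum>s\<in>A. (if lac_freq i s = n then c s / 2 else 0) + (if - lac_freq i s = n then cnj (c s) / 2 else 0))"
  proof (rule sum.cong[OF refl])
    fix s
    have "(\<integral>x. ?T s x \<partial>torus) = c s / 2 * (\<integral>x. trig_character (lac_freq i s + - n) x \<partial>torus)
        + cnj (c s) / 2 * (\<integral>x. trig_character (- lac_freq i s + - n) x \<partial>torus)"
      using int by (simp only: Bochner_Integration.integral_add integrable_mult_right integral_mult_right_zero)
    moreover have "lac_freq i s + - n = 0 \<longleftrightarrow> lac_freq i s = n" "- lac_freq i s + - n = 0 \<longleftrightarrow> - lac_freq i s = n"
      by (metis eq_neg_iff_add_eq_0 minus_minus)+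
    ultimately show "(\<integral>x. ?T s x \<partial>torus) = (if lac_freq i s = n then c s / 2 else 0) + (if - lac_freq i s = n then cnj (c s) / 2 else 0)"
      by (simp only: torus_integral_trig_character) simp
  qed
  finally show ?thesis .
qed

text \<open>Dominated convergence along the partial sums, with the majorant from
  \<open>lac_sum_dominated\<close>.\<close>

lemma fourier_coeff_lac_limit:
  assumes N: "\<And>l. N l \<le> N (Suc l)" and B: "0 < B"
    and small: "\<And>l. (\<Sum>s\<in>{N l..<N (Suc l)}. (norm (c s))\<^sup>2) \<le> (B * (1 / 2) ^ l)\<^sup>2"
  shows "(\<lambda>l. \<Sum>s<N l. (if lac_freq i s = n then c s / 2 else 0) + (if - lac_freq i s = n then cnj (c s) / 2 else 0))
    \<longlonglongrightarrow> fourier_coeff (\<lambda>x. Re (lac_limit i c N x)) n"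
proof -
  let ?f = "\<lambda>x. Re (lac_limit i c N x)"
  obtain D where D: "integrable torus D" "AE x in torus. \<forall>l. norm (lac_sum i c {..<N l} x) \<le> D x"
    using lac_sum_dominated(2)[where i = i and c = c, OF N B small] by blast
  have "(\<lambda>l. \<integral>x. complex_of_real (Re (lac_sum i c {..<N l} x)) * trig_character (- n) x \<partial>torus)
      \<longlonglongrightarrow> (\<integral>x. complex_of_real (?f x) * trig_character (- n) x \<partial>torus)"
  proof (rule integral_dominated_convergence[OF _ _ D(1)])
    show "AE x in torus. (\<lambda>l. complex_of_real (Re (lac_sum i c {..<N l} x)) * trig_character (- n) x)
        \<longlonglongrightarrow> complex_of_real (?f x) * trig_character (- n) x"
      using lac_sum_dominated(1)[where i = i and c = c, OF N B small]
      by eventually_elim (intro tendsto_mult tendsto_const tendsto_of_real tendsto_Re lac_limit_LIMSEQ)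
    show "AE x in torus. norm (complex_of_real (Re (lac_sum i c {..<N l} x)) * trig_character (- n) x) \<le> D x" for l
      using D(2) by eventually_elim (auto simp: norm_mult intro: order_trans[OF abs_Re_le_cmod])
  qed measurable
  also have "(\<integral>x. complex_of_real (?f x) * trig_character (- n) x \<partial>torus) = fourier_coeff ?f n"
    unfolding fourier_coeff_def by (subst torus_integral_lebesgue) auto
  finally show ?thesis by (simp only: torus_integral_Re_lac_sum_character finite_lessThan)
qed

text \<open>All frequencies and their negatives are distinct, so at most one summand in each
  approximating sum is nonzero, and the bound survives the limit.\<close>

lemma norm_fourier_coeff_lac_limit:
  assumes N: "\<And>l. N l \<le> N (Suc l)" and B: "0 < B"
    and small: "\<And>l. (\<Sum>s\<in>{N l..<N (Suc l)}. (norm (c s))\<^sup>2) \<le> (B * (1 / 2) ^ l)\<^sup>2"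
  shows "n = lac_freq i t \<or> n = - lac_freq i t \<Longrightarrow> norm (fourier_coeff (\<lambda>x. Re (lac_limit i c N x)) n) \<le> norm (c t) / 2"
    and "(\<And>t. n \<noteq> lac_freq i t \<and> n \<noteq> - lac_freq i t) \<Longrightarrow> fourier_coeff (\<lambda>x. Re (lac_limit i c N x)) n = 0"
proof -
  let ?E = "\<lambda>l. \<Sum>s<N l. (if lac_freq i s = n then c s / 2 else 0) + (if - lac_freq i s = n then cnj (c s) / 2 else 0)"
  note lim = fourier_coeff_lac_limit[where i = i and c = c and n = n, OF N B small]
  show "norm (fourier_coeff (\<lambda>x. Re (lac_limit i c N x)) n) \<le> norm (c t) / 2"
    if n: "n = lac_freq i t \<or> n = - lac_freq i t"
  proof (rule LIMSEQ_le_const2[OF tendsto_norm[OF lim]], intro exI allI impI)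
    fix l
    have "?E l = (\<Sum>s<N l. if s = t then if n = lac_freq i t then c t / 2 else cnj (c t) / 2 else 0)"
    proof (rule sum.cong[OF refl])
      fix s
      show "(if lac_freq i s = n then c s / 2 else 0) + (if - lac_freq i s = n then cnj (c s) / 2 else 0) =
          (if s = t then if n = lac_freq i t then c t / 2 else cnj (c t) / 2 else 0)"
        using n lac_freq_neq_uminus[of i t s] lac_freq_neq_uminus[of i s t] lac_freq_neq_uminus[of i t t]
        by (elim disjE) (simp_all add: lac_freq_inject eq_commute[of "- lac_freq i s"])
    qed
    then show "norm (?E l) \<le> norm (c t) / 2"
      by (auto simp: norm_divide)
  qed
  show "fourier_coeff (\<lambda>x. Re (lac_limit i c N x)) n = 0" if n: "\<And>t. n \<noteq> lac_freq i t \<and> n \<noteq> - lac_freq i t"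
  proof (rule LIMSEQ_unique[OF lim])
    have "lac_freq i s \<noteq> n" "- lac_freq i s \<noteq> n" for s using n[of s] by auto
    then show "?E \<longlonglongrightarrow> 0" by simp
  qed
qed

text \<open>As \<open>2 ^ (2 * t) = 4 ^ t < 2 ^ (2 * t + 1)\<close>, the frequency
  \<open>4 ^ t\<close> lies in level \<open>2 * t + 1\<close>; the frequency 1 lies in level
  1.\<close>

definition lac_block :: "'m \<Rightarrow> nat \<Rightarrow> nat ^ 'm" where
  "lac_block i t = (\<chi> j. if j = i then 2 * t + 1 else 1)"

lemma dyadic_block_power4:
  assumes "n \<in> dyadic_block s" and "\<bar>n $ j\<bar> = 4 ^ e"
  shows "s $ j = 2 * e + 1"
proof -
  have lo: "\<lfloor>(2::real) powr (real (s $ j) - 1)\<rfloor> \<le> 4 ^ e" and hi: "(4 :: int) ^ e < 2 ^ (s $ j)"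
    using assms(1) unfolding dyadic_block_def assms(2)[symmetric] by auto
  have four: "(4 :: int) ^ e = 2 ^ (2 * e)" by (simp add: power_mult)
  have "2 * e < s $ j" using hi unfolding four by simp
  \<comment> \<open>Level 0, where the floor is that of 1/2, is excluded by the upper bound; at all
    other levels the floor is an exact power of 2.\<close>
  then obtain r where r: "s $ j = Suc r" by (cases "s $ j") auto
  have "\<lfloor>(2::real) powr (real (s $ j) - 1)\<rfloor> = \<lfloor>real_of_int (2 ^ r)\<rfloor>" by (simp add: r powr_realpow)
  also have "\<dots> = 2 ^ r" by (rule floor_of_int)
  finally have "(2 :: int) ^ r \<le> 2 ^ (2 * e)" using lo four by simp
  then have "r \<le> 2 * e" by simp
  then show ?thesis using \<open>2 * e < s $ j\<close> r by simp
qed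

lemma lac_freq_in_dyadic_block:
  assumes "lac_freq i t \<in> dyadic_block s \<or> - lac_freq i t \<in> dyadic_block s"
  shows "s = lac_block i t"
proof -
  have "s $ j = 2 * (if j = i then t else 0) + 1" for j
    using assms by (elim disjE) (erule dyadic_block_power4; simp add: lac_freq_def)+
  then show ?thesis by (simp add: lac_block_def vec_eq_iff)
qed

lemma delta_block_measurable [measurable]: "delta_block s f \<in> borel_measurable borel"
  unfolding delta_block_def by measurable

text \<open>Only the pair of frequencies \<open>lac_freq i t\<close> and
  \<open>- lac_freq i t\<close> can contribute to the block \<open>lac_block i t\<close>, each with
  a coefficient of modulus at most \<open>norm (c t) / 2\<close>.\<close>

lemma norm_delta_block_lac_limit:
  assumes N: "\<And>l. N l \<le> N (Suc l)" and B: "0 < B"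
    and small: "\<And>l. (\<Sum>s\<in>{N l..<N (Suc l)}. (norm (c s))\<^sup>2) \<le> (B * (1 / 2) ^ l)\<^sup>2"
  shows "norm (delta_block (lac_block i t) (\<lambda>x. Re (lac_limit i c N x)) x) \<le> norm (c t)"
    and "s \<notin> range (lac_block i) \<Longrightarrow> norm (delta_block s (\<lambda>x. Re (lac_limit i c N x)) x) \<le> 0"
proof -
  let ?a = "fourier_coeff (\<lambda>x. Re (lac_limit i c N x))"
  note coeff = norm_fourier_coeff_lac_limit[where i = i and c = c, OF N B small]
  show "norm (delta_block (lac_block i t) (\<lambda>x. Re (lac_limit i c N x)) x) \<le> norm (c t)"
  \<comment> \<open>A sum over an infinite set is 0 by convention, so the bound is immediate in the
    other case.\<close>
  proof (cases "finite (dyadic_block (lac_block i t))")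
    case True
    let ?D = "dyadic_block (lac_block i t)" and ?P = "{lac_freq i t, - lac_freq i t}"
    have block: "lac_block i t = lac_block i u \<Longrightarrow> t = u" for u
      by (auto simp: lac_block_def vec_eq_iff dest!: spec[of _ i])
    have "norm (\<Sum>n\<in>?D. ?a n * trig_character n x) \<le> (\<Sum>n\<in>?D. norm (?a n))"
      by (rule sum_norm_le) (simp add: norm_mult)
    also have "\<dots> = (\<Sum>n\<in>?D \<inter> ?P. norm (?a n))"
    proof (rule sum.mono_neutral_right[OF True], blast, intro ballI)
      fix n assume n: "n \<in> ?D - ?D \<inter> ?P"
      have "n \<noteq> lac_freq i u \<and> n \<noteq> - lac_freq i u" for u
        using n lac_freq_in_dyadic_block[of i u "lac_block i t"] block[of u] by auto
      then show "norm (?a n) = 0" using coeff(2) by simp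
    qed
    also have "\<dots> \<le> (\<Sum>n\<in>?P. norm (?a n))" by (intro sum_mono2) auto
    also have "\<dots> = norm (?a (lac_freq i t)) + norm (?a (- lac_freq i t))"
      using lac_freq_neq_uminus[of i t t] by simp
    also have "\<dots> \<le> norm (c t) / 2 + norm (c t) / 2" by (intro add_mono coeff(1)) auto
    finally show ?thesis by (simp add: delta_block_def)
  qed (simp add: delta_block_def)
  show "norm (delta_block s (\<lambda>x. Re (lac_limit i c N x)) x) \<le> 0" if s: "s \<notin> range (lac_block i)"
  proof -
    have "?a n = 0" if n: "n \<in> dyadic_block s" for n
      using n s lac_freq_in_dyadic_block[of i _ s] by (intro coeff(2)) blast
    then show ?thesis by (simp add: delta_block_def)
  qed
qed

text \<open>The three thirds of the interval are translated onto \<open>{0..<d}\<close>, where the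
  integrands cancel pointwise. Splitting the integral needs integrability; without it the integral
  is 0 by convention.\<close>

lemma set_integral_third_period:
  fixes G :: "real \<Rightarrow> real"
  assumes [measurable]: "G \<in> borel_measurable borel"
    and cancel: "\<And>u. G u + G (u + d) + G (u + 2 * d) = 0" and d: "0 < d"
  shows "(LINT u:{0..3 * d}|lebesgue. G u) = 0"
proof (cases "integrable lborel (\<lambda>u. indicator {0..<3 * d} u * G u)")
  case True
  let ?I = "\<lambda>r u. indicator {r * d..<(r + 1) * d} u * G u"
  have piece: "integrable lborel (?I r)" if "0 \<le> r" "r \<le> 2" for r
  proof -
    have "(r + 1) * d \<le> 3 * d" using that d by (intro mult_right_mono) auto
    moreover have "0 \<le> r * d" using that d by simp
    ultimately have *: "?I r = (\<lambda>u. indicator {r * d..<(r + 1) * d} u *\<^sub>R (indicator {0..<3 * d} u * G u))"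
      by (auto simp: indicator_def)
    show ?thesis unfolding * by (rule integrable_mult_indicator[OF _ True]) simp
  qed
  have shift: "(\<lambda>u. indicator {0..<d} u * G (u + r * d)) = (\<lambda>u. ?I r (r * d + 1 * u))" for r
    by (auto simp: indicator_def algebra_simps fun_eq_iff)
  have shift_int: "integrable lborel (\<lambda>u. indicator {0..<d} u * G (u + r * d))" if "0 \<le> r" "r \<le> 2" for r
    unfolding shift by (subst lborel_integrable_real_affine_iff) (use piece[OF that] in auto)
  have shift_eq: "(\<integral>u. indicator {0..<d} u * G (u + r * d) \<partial>lborel) = (\<integral>u. ?I r u \<partial>lborel)" for r
    unfolding shift by (subst (2) lborel_integral_real_affine[of 1 _ "r * d"]) auto
  have "(LINT u:{0..3 * d}|lebesgue. G u) = (\<integral>u. indicator {0..3 * d} u * G u \<partial>lborel)"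
    unfolding set_lebesgue_integral_def by (subst integral_completion) auto
  also have "\<dots> = (\<integral>u. ?I 0 u + ?I 1 u + ?I 2 u \<partial>lborel)"
  proof (rule integral_cong_AE)
    show "AE u in lborel. indicator {0..3 * d} u * G u = ?I 0 u + ?I 1 u + ?I 2 u"
      using AE_lborel_singleton[of "3 * d"] by eventually_elim (use d in \<open>auto simp: indicator_def\<close>)
  qed measurable
  also have "\<dots> = (\<integral>u. ?I 0 u \<partial>lborel) + (\<integral>u. ?I 1 u \<partial>lborel) + (\<integral>u. ?I 2 u \<partial>lborel)"
    by (subst Bochner_Integration.integral_add, (intro Bochner_Integration.integrable_add piece; simp)+)
      (subst Bochner_Integration.integral_add, (intro piece; simp)+, rule refl)
  also have "\<dots> = (\<integral>u. indicator {0..<d} u * G (u + 0 * d) \<partial>lborel) + (\<integral>u. indicator {0..<d} u * G (u + 1 * d) \<partial>lborel)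
      + (\<integral>u. indicator {0..<d} u * G (u + 2 * d) \<partial>lborel)"
    by (simp only: shift_eq)
  also have "\<dots> = (\<integral>u. indicator {0..<d} u * G (u + 0 * d) + indicator {0..<d} u * G (u + 1 * d)
      + indicator {0..<d} u * G (u + 2 * d) \<partial>lborel)"
    by (subst Bochner_Integration.integral_add, (intro Bochner_Integration.integrable_add shift_int; simp)+)
      (subst Bochner_Integration.integral_add, (intro shift_int; simp)+, rule refl)
  also have "\<dots> = (\<integral>u. 0 \<partial>(lborel :: real measure))"
    by (rule Bochner_Integration.integral_cong) (use cancel in \<open>simp_all add: distrib_left[symmetric]\<close>)
  finally show ?thesis by simp
next
  case False
  have "\<not> integrable lborel (\<lambda>u. indicator {0..3 * d} u * G u)"
  proof
    assume "integrable lborel (\<lambda>u. indicator {0..3 * d} u * G u)"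
    from integrable_mult_indicator[OF _ this, of "{0..<3 * d}"]
    have "integrable lborel (\<lambda>u. indicator {0..<3 * d} u * (indicator {0..3 * d} u * G u))" by simp
    also have "(\<lambda>u. indicator {0..<3 * d} u * (indicator {0..3 * d} u * G u)) = (\<lambda>u. indicator {0..<3 * d} u * G u)"
      by (auto simp: indicator_def)
    finally show False using False by simp
  qed
  then have "(\<integral>u. indicator {0..3 * d} u * G u \<partial>lborel) = 0" by (rule not_integrable_integral_eq)
  then show ?thesis
    unfolding set_lebesgue_integral_def by (subst integral_completion) auto
qed

text \<open>The three translates by multiples of \<open>2 * pi / 3\<close> cancel at every point, because the set of
  convergence is invariant under these shifts; if the section is not integrable, then its integral is
  0 by convention.\<close>

lemma section_integral_lac_limit:
  "(LINT u:{0..2 * pi}|lebesgue. Re (lac_limit i c N (\<chi> l. if l = j then u else x $ l))) = 0"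
proof -
  define G where "G u = Re (lac_limit i c N (\<chi> l. if l = j then u else x $ l))" for u
  define \<omega> where "\<omega> = exp (2 * of_real pi * \<i> / 3 :: complex)"
  let ?y = "\<lambda>u. \<chi> l. if l = j then u else x $ l"
  have y: "?y (u + v) = ?y u + axis j v" for u v
    by (simp add: vec_eq_iff axis_def)
  have "continuous_on UNIV (\<lambda>u. if l = j then u else x $ l)" for l
    by (cases "l = j") (auto intro: continuous_on_id continuous_on_const)
  then have "(\<lambda>u. ?y u) \<in> borel_measurable borel"
    by (intro borel_measurable_continuous_onI continuous_on_vec_lambda)
  then have meas: "G \<in> borel_measurable borel"
    unfolding G_def by measurable
  have step: "lac_limit i c N (?y (u + 2 * pi / 3)) = \<omega> * lac_limit i c N (?y u)" for u
    unfolding y \<omega>_def by (rule lac_limit_third_period)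
  have "\<omega> ^ 3 = 1"
    unfolding \<omega>_def by (simp add: exp_of_nat_mult[symmetric] mult_ac exp_eq_1)
  moreover have "\<omega> \<noteq> 1"
  proof
    assume "\<omega> = 1"
    then obtain n :: int where "2 * pi / 3 = real_of_int (2 * n) * pi"
      unfolding \<omega>_def exp_eq_1 by auto
    then have "1 = 3 * n" by (simp add: field_simps)
    then show False by presburger
  qed
  moreover have "\<omega> ^ 3 - 1 = (\<omega> - 1) * (1 + \<omega> + \<omega>\<^sup>2)" by (simp add: algebra_simps power2_eq_square power3_eq_cube)
  ultimately have sum0: "1 + \<omega> + \<omega>\<^sup>2 = 0" by simp
  have "G u + G (u + 2 * pi / 3) + G (u + 2 * (2 * pi / 3)) = 0" for u
  proof -
    have "u + 2 * (2 * pi / 3) = (u + 2 * pi / 3) + 2 * pi / 3" by simp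
    then have "G u + G (u + 2 * pi / 3) + G (u + 2 * (2 * pi / 3)) = Re ((1 + \<omega> + \<omega>\<^sup>2) * lac_limit i c N (?y u))"
      unfolding G_def by (simp only: step) (simp add: algebra_simps power2_eq_square)
    then show ?thesis by (simp add: sum0)
  qed
  then have "(LINT u:{0..3 * (2 * pi / 3)}|lebesgue. G u) = 0"
    by (intro set_integral_third_period meas) auto
  then show ?thesis by (simp add: G_def)
qed

lemma lac_limit_in_lorentz_space0:
  assumes N: "strict_mono N" and B: "0 < B"
    and small: "\<And>l. (\<Sum>s\<in>{N l..<N (Suc l)}. (norm (c s))\<^sup>2) \<le> (B * (1 / 2) ^ l)\<^sup>2"
    and p: "0 < p" "0 < \<tau>" and summ: "summable (\<lambda>s. (norm (c s))\<^sup>2)"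
  shows "(\<lambda>x. Re (lac_limit i c N x)) \<in> lorentz_space0 p \<tau>"
proof -
  have "(\<lambda>x. Re (lac_limit i c N x)) \<in> borel_measurable borel" by measurable
  then have "(\<lambda>x. Re (lac_limit i c N x)) \<in> borel_measurable lebesgue"
    by (intro measurable_completion) simp
  then show ?thesis
    using lorentz_norm_lac_limit_finite[where i = i and c = c, OF N B small p summ]
    by (simp add: lorentz_space0_def lorentz_space_def lac_limit_period section_integral_lac_limit)
qed

subsection \<open>Lacunary series with power coefficients\<close>

definition power_coeff :: "real \<Rightarrow> nat \<Rightarrow> complex" where
  "power_coeff \<gamma> s = complex_of_real ((real s + 1) powr (- \<gamma>))"

lemma norm_power_coeff: "norm (power_coeff \<gamma> s) = (real s + 1) powr (- \<gamma>)"
  unfolding power_coeff_def by (subst norm_of_real) simp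

lemma summable_powr_shift:
  assumes "a < -1"
  shows "summable (\<lambda>s. (real s + 1) powr a)"
proof -
  have "summable (\<lambda>s. real s powr a)"
    using assms by (simp only: summable_real_powr_iff)
  then have "summable (\<lambda>s. real (Suc s) powr a)"
    by (simp only: summable_Suc_iff[of "\<lambda>s. real s powr a"])
  then show ?thesis by (simp only: of_nat_Suc add.commute[of 1])
qed

lemma summable_power_coeff:
  assumes "1 / 2 < \<gamma>"
  shows "summable (\<lambda>s. (norm (power_coeff \<gamma> s))\<^sup>2)"
proof -
  have "(norm (power_coeff \<gamma> s))\<^sup>2 = (real s + 1) powr (- 2 * \<gamma>)" for s
    unfolding norm_power_coeff by (simp add: power2_eq_square powr_add[symmetric])
  then show ?thesis using assms by (simp add: summable_powr_shift)
qed

section \<open>Finiteness of the first norm\<close>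

lemma prod_lac_block:
  "(\<Prod>j\<in>UNIV. (real (lac_block i t $ j) + 1) powr (r j)) = 2 powr (r i) * (\<Prod>j\<in>UNIV - {i}. 2 powr (r j)) * (real t + 1) powr (r i)"
proof -
  have "(\<Prod>j\<in>UNIV. (real (lac_block i t $ j) + 1) powr (r j))
      = (2 * (real t + 1)) powr (r i) * (\<Prod>j\<in>UNIV - {i}. (real (lac_block i t $ j) + 1) powr (r j))"
    \<comment> \<open>Level \<open>2 * t + 1\<close> plus 1 is \<open>2 * (t + 1)\<close>. The other
      coordinates each contribute the constant base 2.\<close>
    by (subst prod.remove[of _ i]) (auto simp: lac_block_def algebra_simps)
  also have "(\<Prod>j\<in>UNIV - {i}. (real (lac_block i t $ j) + 1) powr (r j)) = (\<Prod>j\<in>UNIV - {i}. 2 powr (r j))"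
    by (intro prod.cong) (auto simp: lac_block_def)
  also have "(2 * (real t + 1)) powr (r i) = 2 powr (r i) * (real t + 1) powr (r i)"
    by (subst powr_mult) auto
  finally show ?thesis by (simp only: mult_ac)
qed

lemma lorentz_norm_delta_block_lac_limit:
  assumes N: "\<And>l. N l \<le> N (Suc l)" and B: "0 < B"
    and small: "\<And>l. (\<Sum>s\<in>{N l..<N (Suc l)}. (norm (c s))\<^sup>2) \<le> (B * (1 / 2) ^ l)\<^sup>2"
    and p: "0 < p" "0 < \<tau>"
  shows "lorentz_norm p \<tau> (delta_block (lac_block i t) (\<lambda>x. Re (lac_limit i c N x))) \<le> ennreal (norm (c t))"
    and "s \<notin> range (lac_block i) \<Longrightarrow> lorentz_norm p \<tau> (delta_block s (\<lambda>x. Re (lac_limit i c N x))) = 0"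
proof -
  note bound = norm_delta_block_lac_limit[where i = i and c = c, OF N B small]
  show "lorentz_norm p \<tau> (delta_block (lac_block i t) (\<lambda>x. Re (lac_limit i c N x))) \<le> ennreal (norm (c t))"
    by (intro lorentz_norm_le_bound p bound(1)) auto
  show "lorentz_norm p \<tau> (delta_block s (\<lambda>x. Re (lac_limit i c N x))) = 0" if "s \<notin> range (lac_block i)"
    using lorentz_norm_le_bound[of "delta_block s (\<lambda>x. Re (lac_limit i c N x))" p \<tau> 0] p bound(2)[OF that] by simp
qed

lemma infsum_ennreal_le:
  fixes F :: "'a \<Rightarrow> ennreal"
  assumes "\<And>S. finite S \<Longrightarrow> sum F S \<le> K"
  shows "infsum F UNIV \<le> K"
  using assms by (subst nonneg_infsum_complete) (auto intro!: SUP_least)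

text \<open>Only the blocks \<open>lac_block i t\<close> contribute, so up to a constant the norm is
  governed by the powers \<open>(real t + 1) powr (r $ i - \<gamma>)\<close>: their supremum for
  \<open>\<theta> = \<infinity>\<close>, otherwise the convergent series of their
  \<open>q\<close>-th powers.\<close>

lemma SB_norm_lac_limit_finite:
  fixes i :: "'m :: finite"
  assumes N: "\<And>l. N l \<le> N (Suc l)" and B: "0 < B"
    and small: "\<And>l. (\<Sum>s\<in>{N l..<N (Suc l)}. (norm (power_coeff \<gamma> s))\<^sup>2) \<le> (B * (1 / 2) ^ l)\<^sup>2"
    and p: "0 < p" "0 < \<tau>"
    and \<theta>: "\<theta> = \<infinity> \<and> r $ i \<le> \<gamma> \<or> \<theta> = ereal q \<and> 0 < q \<and> (r $ i - \<gamma>) * q < - 1"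
  shows "SB_norm p \<tau> \<theta> r (\<lambda>x. Re (lac_limit i (power_coeff \<gamma>) N x)) < \<infinity>"
  using \<theta>
proof (elim disjE conjE)
  note bound = lorentz_norm_delta_block_lac_limit[where i = i and c = "power_coeff \<gamma>", OF N B small p]
  let ?f = "\<lambda>x. Re (lac_limit i (power_coeff \<gamma>) N x)"
  {
    assume \<theta>: "\<theta> = \<infinity>" and r: "r $ i \<le> \<gamma>"
    let ?P = "2 powr (r $ i) * (\<Prod>j\<in>UNIV - {i}. 2 powr (r $ j))"
    have "ennreal (\<Prod>j\<in>UNIV. (real (s $ j) + 1) powr (r $ j)) * lorentz_norm p \<tau> (delta_block s ?f) \<le> ennreal ?P" for s
    proof (cases "s \<in> range (lac_block i)")
      case True
      then obtain t where t: "s = lac_block i t" by auto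
      have "ennreal (\<Prod>j\<in>UNIV. (real (s $ j) + 1) powr (r $ j)) * lorentz_norm p \<tau> (delta_block s ?f)
          \<le> ennreal (?P * (real t + 1) powr (r $ i)) * ennreal ((real t + 1) powr (- \<gamma>))"
        unfolding t prod_lac_block norm_power_coeff[symmetric] by (intro mult_left_mono bound(1)) simp
      also have "\<dots> = ennreal (?P * (real t + 1) powr (r $ i - \<gamma>))"
        by (simp add: ennreal_mult''[symmetric] powr_add[symmetric] mult.assoc)
      also have "\<dots> \<le> ennreal (?P * 1)"
      proof (intro ennreal_leI mult_left_mono)
        have "(real t + 1) powr (r $ i - \<gamma>) \<le> (real t + 1) powr 0"
          using r by (intro powr_mono) auto
        then show "(real t + 1) powr (r $ i - \<gamma>) \<le> 1" by simp
      qed (auto intro!: mult_nonneg_nonneg prod_nonneg)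
      finally show ?thesis by simp
    next
      case False
      then show ?thesis by (simp add: bound(2))
    qed
    then have "SB_norm p \<tau> \<theta> r ?f \<le> ennreal ?P"
      unfolding SB_norm_def using \<theta> by (auto intro!: SUP_least)
    also have "\<dots> < \<infinity>" by simp
    finally show ?thesis .
  next
    assume \<theta>: "\<theta> = ereal q" and q: "0 < q" and r: "(r $ i - \<gamma>) * q < - 1"
    define F where "F s = ennreal (\<Prod>j\<in>UNIV. (real (s $ j) + 1) powr (r $ j * q)) * ennreal_powr (lorentz_norm p \<tau> (delta_block s ?f)) q"
      for s :: "nat ^ 'm"
    define P where "P = 2 powr (r $ i * q) * (\<Prod>j\<in>UNIV - {i}. 2 powr (r $ j * q))"
    define G where "G t = P * (real t + 1) powr ((r $ i - \<gamma>) * q)" for t :: nat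
    have P: "0 \<le> P" unfolding P_def by (auto intro!: mult_nonneg_nonneg prod_nonneg)
    have G: "summable G" unfolding G_def by (intro summable_mult summable_powr_shift r)
    have G0: "0 \<le> G t" for t using P by (simp add: G_def)
    have F0: "F s = 0" if "s \<notin> range (lac_block i)" for s
      using that q by (simp add: F_def bound(2) ennreal_powr_def)
    have F: "F (lac_block i t) \<le> ennreal (G t)" for t
    proof -
      have "F (lac_block i t) \<le> ennreal (P * (real t + 1) powr (r $ i * q)) * ennreal_powr (ennreal ((real t + 1) powr (- \<gamma>))) q"
        unfolding F_def prod_lac_block P_def norm_power_coeff[symmetric]
        by (intro mult_left_mono ennreal_powr_mono bound(1) q) simp
      also have "\<dots> = ennreal (P * ((real t + 1) powr (r $ i * q) * (real t + 1) powr (- \<gamma> * q)))"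
        using P by (simp add: ennreal_powr_ennreal ennreal_mult''[symmetric] powr_powr mult.assoc)
      also have "\<dots> = ennreal (G t)"
        by (simp add: G_def powr_add[symmetric] algebra_simps)
      finally show ?thesis .
    qed
    have inj: "inj (lac_block i)"
      by (auto simp: inj_def lac_block_def vec_eq_iff dest!: spec[of _ i])
    have "infsum F UNIV \<le> ennreal (suminf G)"
    proof (rule infsum_ennreal_le)
      fix S :: "(nat ^ 'm) set" assume S: "finite S"
      let ?T = "lac_block i -` S"
      have T: "finite ?T" using S inj by (rule finite_vimageI)
      have "sum F S = sum F (lac_block i ` ?T)"
        using S F0 by (intro sum.mono_neutral_right) auto
      also have "\<dots> = (\<Sum>t\<in>?T. F (lac_block i t))"
        using inj by (subst sum.reindex) (auto intro: inj_on_subset)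
      also have "\<dots> \<le> (\<Sum>t\<in>?T. ennreal (G t))" by (intro sum_mono F)
      also have "\<dots> = ennreal (\<Sum>t\<in>?T. G t)" using G0 by (simp add: sum_ennreal)
      also have "\<dots> \<le> ennreal (suminf G)"
        using G G0 T by (intro ennreal_leI sum_le_suminf) auto
      finally show "sum F S \<le> ennreal (suminf G)" .
    qed
    also have "\<dots> < \<infinity>" by simp
    finally have "ennreal_powr (infsum F UNIV) (1 / q) < \<infinity>" by (rule ennreal_powr_less_top)
    then show ?thesis using \<theta> by (simp add: SB_norm_def F_def[abs_def] Let_def)
  }
qed

text \<open>The phase is \<open>4 ^ (s - n)\<close> thirds of a full turn, and
  \<open>4 ^ (s - n)\<close> is 1 modulo 3; hence all frequencies from index \<open>n\<close> on see
  the same cube root of unity, never 1.\<close>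

lemma trig_lac_freq_third:
  assumes "n \<le> s"
  shows "trig_character (lac_freq i s) (axis i (2 * pi / (3 * 4 ^ n))) = exp (2 * of_real pi * \<i> / 3)"
proof -
  define e where "e = s - n"
  have s: "s = n + e" using assms by (simp add: e_def)
  have "4 ^ e mod (3 :: int) = 1"
    by (induction e) (simp, simp, presburger)
  then obtain m where m: "(4 :: int) ^ e = 3 * m + 1" by (metis mult_div_mod_eq)
  have "(4 :: real) ^ e = real_of_int (4 ^ e)" by simp
  then have "(4 :: real) ^ e = 3 * real_of_int m + 1" unfolding m by simp
  then have "real_of_int (lac_freq i s $ i) * (2 * pi / (3 * 4 ^ n)) = 2 * pi / 3 + 2 * real_of_int m * pi"
    by (simp add: lac_freq_def s power_add field_simps)
  then show ?thesis
    unfolding trig_character_axis exp_eq by (intro exI[of _ m]) (simp add: field_simps)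
qed

text \<open>For the step \<open>2 * pi / (3 * 4 ^ n)\<close> in \<open>x\<^sub>i\<close>, all terms of index at least \<open>n\<close> acquire a factor
  of the same modulus, so the modulus of smoothness dominates the \<open>\<ell>\<^sub>2\<close> norm of the tail of the
  coefficients.\<close>

lemma mixed_modulus_lac_limit_ge:
  fixes i :: "'m :: finite"
  assumes N: "strict_mono N" and B: "0 < B"
    and small: "\<And>l. (\<Sum>s\<in>{N l..<N (Suc l)}. (norm (power_coeff \<gamma> s))\<^sup>2) \<le> (B * (1 / 2) ^ l)\<^sup>2"
    and p: "0 < p" "0 < \<tau>" and \<gamma>: "0 < \<gamma>"
  shows "\<exists>K>0. \<forall>r t. (\<forall>j. (if j = i then 1 / 4 ^ r else 1) / 2 \<le> t $ j) \<longrightarrow>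
    ennreal (K * (real r + 2) powr (1 / 2 - \<gamma>)) \<le> mixed_modulus k p \<tau> (\<lambda>x. Re (lac_limit i (power_coeff \<gamma>) N x)) t"
proof -
  \<comment> \<open>The value of the characters at the step in direction \<open>j\<close>. In the
    directions other than \<open>i\<close> all frequencies are 1 and the step is 1/2. Both phases
    lie strictly between 0 and \<open>2 * pi\<close>, so \<open>z j\<close> is never 1.\<close>
  define z where "z j = (if j = i then exp (2 * of_real pi * \<i> / 3) else exp (\<i> * complex_of_real (1 / 2)))" for j
  define \<Lambda> where "\<Lambda> = (\<Prod>j\<in>UNIV. norm (z j - 1) ^ (k $ j))"
  have "z j \<noteq> 1" for j
  proof
    assume "z j = 1"
    then obtain n :: int where n: "(if j = i then 2 * pi / 3 else 1 / 2) = real_of_int (2 * n) * pi"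
      unfolding z_def by (auto simp: exp_eq_1 split: if_splits)
    have "0 < (if j = i then 2 * pi / 3 else 1 / 2)" by simp
    then have "1 \<le> n" unfolding n by (simp add: zero_less_mult_iff)
    then have "2 * 1 * pi \<le> real_of_int (2 * n) * pi" by (intro mult_right_mono) auto
    moreover have "(if j = i then 2 * pi / 3 else 1 / 2) < 2 * 1 * pi" using pi_gt3 by simp
    ultimately show False unfolding n by simp
  qed
  then have \<Lambda>: "0 < \<Lambda>" unfolding \<Lambda>_def by (intro prod_pos) simp
  define K0 where "K0 = \<Lambda> / 2 * 2 powr (- \<gamma>)"
  have K0: "0 < K0" using \<Lambda> by (simp add: K0_def)
  define K where "K = K0 / 2 * lac_prob_const powr (1 / p)"
  have K: "0 < K" using K0 lac_prob_const_pos by (simp add: K_def)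
  have "ennreal (K * (real r + 2) powr (1 / 2 - \<gamma>)) \<le> mixed_modulus k p \<tau> (\<lambda>x. Re (lac_limit i (power_coeff \<gamma>) N x)) t"
    if t: "\<And>j. (if j = i then 1 / 4 ^ r else 1) / 2 \<le> t $ j" for r t
  proof -
    \<comment> \<open>The step \<open>2 * pi / (3 * 4 ^ n)\<close> must not exceed
      \<open>1 / 4 ^ r / 2\<close>. The choice \<open>r + 1\<close> would just fail, since
      \<open>2 * pi / 12 > 1 / 2\<close>.\<close>
    define n where "n = r + 2"
    define h :: "real ^ 'm" where "h = (\<chi> j. if j = i then 2 * pi / (3 * 4 ^ n) else 1 / 2)"
    have h_le: "\<bar>h $ j\<bar> \<le> t $ j" for j
    proof -
      have "2 * pi / (3 * 4 ^ n) \<le> 1 / 4 ^ r / 2"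
        using pi_less_4 by (simp add: n_def power_add field_simps)
      then show ?thesis using t[of j] by (simp add: h_def split: if_splits)
    qed
    have mult: "norm (diff_mult i k h UNIV s) = \<Lambda>" if "n \<le> s" for s
    proof -
      have "trig_character (lac_freq i s) (axis j (h $ j)) = z j" for j
        using that trig_lac_freq_third[of n s i] by (simp add: h_def z_def trig_character_axis lac_freq_def)
      then show ?thesis by (simp add: diff_mult_def \<Lambda>_def prod_norm[symmetric] norm_power)
    qed
    define y where "y = K0 * real n powr (1 / 2 - \<gamma>)"
    have n0: "0 < real n" by (simp add: n_def)
    have y: "0 < y" using K0 n0 by (simp add: y_def)
    \<comment> \<open>The \<open>n\<close> indices in \<open>{n..<2 * n}\<close> have coefficients
      at least \<open>(2 * real n) powr (- \<gamma>)\<close>. The factors 1/2 and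
      \<open>2 powr (- \<gamma>)\<close> in \<open>K0\<close> absorb the 4 and the 2 here.\<close>
    have "4 * y\<^sup>2 = \<Lambda>\<^sup>2 * ((2 powr (- \<gamma>))\<^sup>2 * (real n powr (1 / 2 - \<gamma>))\<^sup>2)"
      by (simp add: y_def K0_def power_mult_distrib power_divide)
    also have "(real n powr (1 / 2 - \<gamma>))\<^sup>2 = real n * (real n powr (- \<gamma>))\<^sup>2"
    proof -
      have "real n powr (1 / 2 - \<gamma>) = sqrt (real n) * real n powr (- \<gamma>)"
        using n0 by (simp add: powr_half_sqrt[symmetric] powr_add[symmetric])
      then show ?thesis by (simp add: power_mult_distrib)
    qed
    also have "\<Lambda>\<^sup>2 * ((2 powr (- \<gamma>))\<^sup>2 * (real n * (real n powr (- \<gamma>))\<^sup>2)) = (\<Sum>s\<in>{n..<2 * n}. (\<Lambda> * (2 * real n) powr (- \<gamma>))\<^sup>2)"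
      by (simp add: powr_mult power_mult_distrib)
    also have "\<dots> \<le> (\<Sum>s\<in>{n..<2 * n}. (norm (diff_mult i k h UNIV s * power_coeff \<gamma> s))\<^sup>2)"
    proof (intro sum_mono power_mono)
      fix s assume s: "s \<in> {n..<2 * n}"
      then have "real s + 1 \<le> 2 * real n" by auto
      then have "(2 * real n) powr (- \<gamma>) \<le> (real s + 1) powr (- \<gamma>)"
        using \<gamma> by (intro powr_mono2') auto
      then show "\<Lambda> * (2 * real n) powr (- \<gamma>) \<le> norm (diff_mult i k h UNIV s * power_coeff \<gamma> s)"
        using s mult[of s] \<Lambda> by (simp add: norm_mult norm_power_coeff mult_left_mono)
    qed (use \<Lambda> in simp)
    finally have "ennreal (y / 2 * lac_prob_const powr (1 / p)) \<le> lorentz_norm p \<tau> (mixed_difference k h (\<lambda>x. Re (lac_limit i (power_coeff \<gamma>) N x)))"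
      by (rule lorentz_norm_mixed_difference_ge[OF N B small p finite_atLeastLessThan y])
    also have "\<dots> \<le> mixed_modulus k p \<tau> (\<lambda>x. Re (lac_limit i (power_coeff \<gamma>) N x)) t"
      unfolding mixed_modulus_def using h_le by (intro SUP_upper) auto
    also have "y / 2 * lac_prob_const powr (1 / p) = K * (real r + 2) powr (1 / 2 - \<gamma>)"
      by (simp add: y_def K_def n_def add.commute)
    finally show ?thesis .
  qed
  then show ?thesis using K by blast
qed

section \<open>Divergence of the modulus norm\<close>

lemma powr_ge_within_factor_two:
  fixes x u a :: real
  assumes "0 < x" "x / 2 \<le> u" "u \<le> 2 * x"
  shows "x powr a * 2 powr (- \<bar>a\<bar>) \<le> u powr a"
proof (cases "0 \<le> a")
  case True
  have "x powr a * 2 powr (- \<bar>a\<bar>) = (x / 2) powr a"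
    using assms True by (simp add: powr_divide powr_minus_divide)
  also have "\<dots> \<le> u powr a" using assms True by (intro powr_mono2) auto
  finally show ?thesis .
next
  case False
  have "x powr a * 2 powr (- \<bar>a\<bar>) = (2 * x) powr a"
    using assms False by (simp add: powr_mult)
  also have "\<dots> \<le> u powr a" using assms False by (intro powr_mono2') auto
  finally show ?thesis .
qed

text \<open>The modulus integral diverges already on the disjoint dyadic boxes \<open>corner_box i r\<close>.\<close>

definition corner :: "'m \<Rightarrow> nat \<Rightarrow> real ^ 'm" where
  "corner i r = (\<chi> j. if j = i then 1 / 4 ^ r else 1)"

definition corner_box :: "'m \<Rightarrow> nat \<Rightarrow> (real ^ 'm) set" where
  "corner_box i r = {t. \<forall>j. corner i r $ j / 2 \<le> t $ j \<and> t $ j \<le> corner i r $ j}"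

lemma corner_box_cbox: "corner_box i r = cbox (corner i r /\<^sub>R 2) (corner i r)"
  by (auto simp: corner_box_def mem_box_cart)

lemma corner_pos: "0 < corner i r $ j"
  by (simp add: corner_def)

lemma prod_corner: "(\<Prod>j\<in>UNIV. corner i r $ j) = 1 / 4 ^ r"
  by (simp add: corner_def)

lemma emeasure_corner_box:
  fixes i :: "'m :: finite"
  shows "emeasure lebesgue (corner_box i r) = ennreal ((1 / 2) ^ CARD('m) / 4 ^ r)"
proof -
  have le: "(corner i r /\<^sub>R 2) $ j \<le> corner i r $ j" for j
    using corner_pos[of i r j] by simp
  have "emeasure lebesgue (corner_box i r) = emeasure lborel (cbox (corner i r /\<^sub>R 2) (corner i r))"
    by (simp add: corner_box_cbox)
  also have "\<dots> = ennreal (measure lborel (cbox (corner i r /\<^sub>R 2) (corner i r)))"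
    using emeasure_lborel_cbox_finite[of "corner i r /\<^sub>R 2" "corner i r"]
    by (intro emeasure_eq_ennreal_measure) auto
  also have "measure lborel (cbox (corner i r /\<^sub>R 2) (corner i r)) = (\<Prod>j\<in>UNIV. corner i r $ j - (corner i r /\<^sub>R 2) $ j)"
    using le by (intro content_cbox_cart) (simp add: interval_ne_empty_cart)
  also have "\<dots> = (\<Prod>j\<in>UNIV. corner i r $ j * (1 / 2))"
    by (intro prod.cong refl) simp
  also have "\<dots> = (1 / 2) ^ CARD('m) / 4 ^ r"
    by (simp only: prod.distrib prod_corner) simp
  finally show ?thesis .
qed

text \<open>In coordinate \<open>i\<close> each box spans a factor 2, while consecutive corners
  differ by a factor 4.\<close>

lemma corner_box_disjoint:
  assumes "t \<in> corner_box i r" "t \<in> corner_box i r'"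
  shows "r = r'"
  using assms
proof (induction r r' rule: linorder_wlog)
  case (le r r')
  show ?case
  proof (rule ccontr)
    assume "r \<noteq> r'"
    then have "(4 :: real) ^ Suc r \<le> 4 ^ r'" using le by (intro power_increasing) auto
    then have "1 / 4 ^ r' \<le> 1 / (4 :: real) ^ Suc r" by (intro divide_left_mono) auto
    moreover have "1 / 4 ^ r / 2 \<le> t $ i" "t $ i \<le> 1 / 4 ^ r'"
      using le by (auto simp: corner_box_def corner_def dest: spec[of _ i])
    ultimately have "1 / (4 :: real) ^ r / 2 \<le> 1 / 4 ^ Suc r" by linarith
    then show False by (simp add: field_simps)
  qed
qed simp

text \<open>On the box, \<open>1 - log 2 (t $ j)\<close> lies within a factor 2 of
  \<open>real r + 2\<close> for \<open>j = i\<close> and of 1 otherwise. Exponents of either sign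
  then cost at most \<open>2 powr (- \<bar>w j\<bar>)\<close>.\<close>

lemma corner_weight_ge:
  fixes i :: "'m :: finite" and w :: "'m \<Rightarrow> real"
  assumes "t \<in> corner_box i r"
  shows "(real r + 2) powr (w i) * 4 ^ r * (\<Prod>j\<in>UNIV. 2 powr (- \<bar>w j\<bar>)) \<le> (\<Prod>j\<in>UNIV. (1 - log 2 (t $ j)) powr (w j) / t $ j)"
proof -
  let ?u = "\<lambda>j. if j = i then real r + 2 else 1" and ?v = "\<lambda>j. if j = i then 4 ^ r else (1 :: real)"
  have "(real r + 2) powr (w i) * 4 ^ r * (\<Prod>j\<in>UNIV. 2 powr (- \<bar>w j\<bar>))
      = (\<Prod>j\<in>UNIV. ?u j powr (w j) * 2 powr (- \<bar>w j\<bar>) * ?v j)"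
  proof -
    have "(\<Prod>j\<in>UNIV. ?u j powr (w j)) = (\<Prod>j\<in>UNIV. if j = i then (real r + 2) powr (w j) else 1)"
      by (intro prod.cong refl) simp
    then have "(\<Prod>j\<in>UNIV. ?u j powr (w j)) = (real r + 2) powr (w i)" by simp
    then show ?thesis by (simp add: prod.distrib)
  qed
  also have "\<dots> \<le> (\<Prod>j\<in>UNIV. (1 - log 2 (t $ j)) powr (w j) / t $ j)"
  proof (rule prod_mono, intro conjI)
    fix j
    have t: "corner i r $ j / 2 \<le> t $ j" "t $ j \<le> corner i r $ j"
      using assms by (auto simp: corner_box_def)
    have t0: "0 < t $ j" using t corner_pos[of i r j] by linarith
    have c: "log 2 (corner i r $ j) = (if j = i then - 2 * real r else 0)"
    proof -
      have "(4 :: real) ^ r = 2 ^ (2 * r)" by (simp add: power_mult)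
      then show ?thesis by (simp add: corner_def log_divide log_nat_power)
    qed
    have "log 2 (t $ j) \<le> log 2 (corner i r $ j)" using t t0 corner_pos[of i r j] by simp
    moreover have "log 2 (corner i r $ j / 2) \<le> log 2 (t $ j)" using t t0 corner_pos[of i r j] by (subst log_le_cancel_iff) auto
    then have "log 2 (corner i r $ j) - 1 \<le> log 2 (t $ j)" using corner_pos[of i r j] by (simp add: log_divide)
    ultimately have "?u j / 2 \<le> 1 - log 2 (t $ j)" "1 - log 2 (t $ j) \<le> 2 * ?u j"
      unfolding c by (auto split: if_splits)
    then have "?u j powr (w j) * 2 powr (- \<bar>w j\<bar>) \<le> (1 - log 2 (t $ j)) powr (w j)"
      by (intro powr_ge_within_factor_two) auto
    moreover have "?v j \<le> 1 / t $ j"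
    proof -
      have "1 / corner i r $ j \<le> 1 / t $ j" using t t0 by (intro divide_left_mono) auto
      then show ?thesis by (simp add: corner_def split: if_splits)
    qed
    ultimately have "?u j powr (w j) * 2 powr (- \<bar>w j\<bar>) * ?v j \<le> (1 - log 2 (t $ j)) powr (w j) * (1 / t $ j)"
      by (intro mult_mono) auto
    then show "?u j powr (w j) * 2 powr (- \<bar>w j\<bar>) * ?v j \<le> (1 - log 2 (t $ j)) powr (w j) / t $ j" by simp
    show "0 \<le> ?u j powr (w j) * 2 powr (- \<bar>w j\<bar>) * ?v j" by simp
  qed
  finally show ?thesis .
qed

text \<open>The boxes are disjoint with volume proportional to \<open>1 / 4 ^ r\<close>, so the
  lower bounds integrate to a multiple of the harmonic series. Comparing with simple functions from
  below leaves \<open>H\<close> arbitrary; in the application it contains a supremum over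
  uncountably many steps.\<close>

lemma nn_integral_top_corner_boxes:
  fixes i :: "'m :: finite" and H :: "real ^ 'm \<Rightarrow> ennreal"
  assumes C: "0 < C" and H: "\<And>r t. t \<in> corner_box i r \<Longrightarrow> ennreal (C * 4 ^ r / (real r + 2)) \<le> H t"
  shows "(\<integral>\<^sup>+ t. H t \<partial>lebesgue) = \<infinity>"
proof (rule ccontr)
  assume "(\<integral>\<^sup>+ t. H t \<partial>lebesgue) \<noteq> \<infinity>"
  then obtain I where I: "0 \<le> I" "(\<integral>\<^sup>+ t. H t \<partial>lebesgue) = ennreal I"
    by (cases "\<integral>\<^sup>+ t. H t \<partial>lebesgue") auto
  define C' where "C' = C * (1 / 2) ^ CARD('m)"
  have C': "0 < C'" using C by (simp add: C'_def)
  let ?c = "\<lambda>r. C * 4 ^ r / (real r + 2)"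
  have meas: "corner_box i r \<in> sets lebesgue" for r by (simp add: corner_box_cbox)
  have "(\<Sum>r<n. C' * inverse (real (r + 2))) \<le> I" for n
  proof -
    have "ennreal (\<Sum>r<n. C' * inverse (real (r + 2))) = (\<Sum>r<n. ennreal (?c r) * emeasure lebesgue (corner_box i r))"
    proof -
      have "ennreal (?c r) * emeasure lebesgue (corner_box i r) = ennreal (C' * inverse (real (r + 2)))" for r
        unfolding emeasure_corner_box using C
        by (subst ennreal_mult''[symmetric]) (auto simp: C'_def field_simps)
      then show ?thesis using C' by (simp add: sum_ennreal)
    qed
    also have "\<dots> = (\<integral>\<^sup>+ t. (\<Sum>r<n. ennreal (?c r) * indicator (corner_box i r) t) \<partial>lebesgue)"
      using meas by (subst nn_integral_sum) (auto simp: nn_integral_cmult_indicator)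
    also have "\<dots> \<le> (\<integral>\<^sup>+ t. H t \<partial>lebesgue)"
    proof (rule nn_integral_mono)
      fix t
      show "(\<Sum>r<n. ennreal (?c r) * indicator (corner_box i r) t) \<le> H t"
      proof (cases "\<exists>r. t \<in> corner_box i r")
        case True
        then obtain r where r: "t \<in> corner_box i r" by blast
        have "(\<Sum>r'<n. ennreal (?c r') * indicator (corner_box i r') t) = (\<Sum>r'<n. if r' = r then ennreal (?c r) else 0)"
        proof (rule sum.cong[OF refl])
          fix r'
          show "ennreal (?c r') * indicator (corner_box i r') t = (if r' = r then ennreal (?c r) else 0)"
            using r corner_box_disjoint[OF r, of r'] by (cases "r' = r") (auto simp: indicator_def)
        qed
        also have "\<dots> \<le> ennreal (?c r)" by simp
        also have "\<dots> \<le> H t" by (rule H[OF r])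
        finally show ?thesis .
      qed simp
    qed
    finally show ?thesis using I by (simp add: ennreal_le_iff)
  qed
  then have "summable (\<lambda>r. C' * inverse (real (r + 2)))"
    using C' by (intro summableI_nonneg_bounded[of _ I]) auto
  then have "summable (\<lambda>r. inverse (real (r + 2)))"
    using C' by (simp add: summable_cmult_iff)
  then have "summable (\<lambda>r. inverse (real r))" by (rule summable_iff_shift[THEN iffD1])
  then show False using not_summable_harmonic[where 'a = real] by simp
qed

text \<open>For finite \<open>\<theta>\<close>, modulus and weight together are on the box of index
  \<open>r\<close> at least of order
  \<open>4 ^ r * (real r + 2) powr (q * (b $ i + 1 / 2 - \<gamma>))\<close>, and the exponent is at
  least \<open>- 1\<close>. For \<open>\<theta> = \<infinity>\<close> the values at the corners
  already grow like a positive power of \<open>real r + 2\<close>.\<close>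

lemma SB_modulus_norm_lac_limit_infinite:
  fixes i :: "'m :: finite"
  assumes N: "strict_mono N" and B: "0 < B"
    and small: "\<And>l. (\<Sum>s\<in>{N l..<N (Suc l)}. (norm (power_coeff \<gamma> s))\<^sup>2) \<le> (B * (1 / 2) ^ l)\<^sup>2"
    and p: "0 < p" "0 < \<tau>" and \<gamma>: "0 < \<gamma>"
    and \<theta>: "\<theta> = \<infinity> \<and> \<gamma> < b $ i + 1 / 2 \<or> \<theta> = ereal q \<and> 0 < q \<and> - 1 \<le> q * (b $ i + 1 / 2 - \<gamma>)"
  shows "SB_modulus_norm k p \<tau> \<theta> b (\<lambda>x. Re (lac_limit i (power_coeff \<gamma>) N x)) = \<infinity>"
  using \<theta>
proof (elim disjE conjE)
  let ?f = "\<lambda>x. Re (lac_limit i (power_coeff \<gamma>) N x)"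
  let ?\<omega> = "mixed_modulus k p \<tau> ?f"
  obtain K where K: "0 < K"
    "\<forall>r t. (\<forall>j. (if j = i then 1 / 4 ^ r else 1) / 2 \<le> t $ j) \<longrightarrow> ennreal (K * (real r + 2) powr (1 / 2 - \<gamma>)) \<le> ?\<omega> t"
    using mixed_modulus_lac_limit_ge[OF N B small p \<gamma>, of i k] by (elim exE conjE) (rule that)
  have \<omega>: "ennreal (K * (real r + 2) powr (1 / 2 - \<gamma>)) \<le> ?\<omega> t" if "t \<in> corner_box i r" for r t
    using that by (intro K(2)[rule_format]) (simp add: corner_box_def corner_def)
  {
    assume \<theta>: "\<theta> = \<infinity>" and b: "\<gamma> < b $ i + 1 / 2"
    define a where "a = b $ i + 1 / 2 - \<gamma>"
    have a: "0 < a" using b by (simp add: a_def)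
    let ?S = "SUP t\<in>{t. \<forall>j. 0 < t $ j \<and> t $ j \<le> 1}. ?\<omega> t * ennreal (\<Prod>j\<in>UNIV. (1 - log 2 (t $ j)) powr (b $ j))"
    have ge: "ennreal (K * 2 powr (- \<bar>b $ i\<bar>) * (real r + 2) powr a) \<le> ?S" for r
    proof -
      let ?t = "corner i r"
      have log4: "log 2 (1 / 4 ^ r) = - 2 * real r"
      proof -
        have "(4 :: real) ^ r = 2 ^ (2 * r)" by (simp add: power_mult)
        then show ?thesis by (simp add: log_divide log_nat_power)
      qed
      have "(\<Prod>j\<in>UNIV. (1 - log 2 (?t $ j)) powr (b $ j)) = (\<Prod>j\<in>UNIV. if j = i then (1 + 2 * real r) powr (b $ j) else 1)"
        by (intro prod.cong refl) (simp add: corner_def log4)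
      also have "\<dots> = (1 + 2 * real r) powr (b $ i)" by simp
      finally have prod: "(\<Prod>j\<in>UNIV. (1 - log 2 (?t $ j)) powr (b $ j)) = (1 + 2 * real r) powr (b $ i)" .
      have w: "(real r + 2) powr (b $ i) * 2 powr (- \<bar>b $ i\<bar>) \<le> (1 + 2 * real r) powr (b $ i)"
        by (intro powr_ge_within_factor_two) auto
      have eq: "K * 2 powr (- \<bar>b $ i\<bar>) * (real r + 2) powr a = K * (real r + 2) powr (1 / 2 - \<gamma>) * ((real r + 2) powr (b $ i) * 2 powr (- \<bar>b $ i\<bar>))"
        by (simp add: a_def powr_add[symmetric] algebra_simps)
      have "ennreal (K * 2 powr (- \<bar>b $ i\<bar>) * (real r + 2) powr a) = ennreal (K * (real r + 2) powr (1 / 2 - \<gamma>)) * ennreal ((real r + 2) powr (b $ i) * 2 powr (- \<bar>b $ i\<bar>))"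
        unfolding eq by (rule ennreal_mult'') simp
      also have "\<dots> \<le> ?\<omega> ?t * ennreal (\<Prod>j\<in>UNIV. (1 - log 2 (?t $ j)) powr (b $ j))"
        unfolding prod by (intro mult_mono \<omega> ennreal_leI w) (auto simp: corner_box_def corner_pos less_imp_le)
      also have "\<dots> \<le> ?S"
        by (intro SUP_upper) (auto simp: corner_pos, simp add: corner_def)
      finally show ?thesis .
    qed
    have "?S = \<infinity>"
    proof (rule ccontr)
      assume "?S \<noteq> \<infinity>"
      then obtain I where I: "0 \<le> I" "?S = ennreal I" by (cases ?S) auto
      have "\<exists>r. I < K * 2 powr (- \<bar>b $ i\<bar>) * (real r + 2) powr a"
      proof -
        define L where "L = K * 2 powr (- \<bar>b $ i\<bar>)"
        have L: "0 < L" using K by (simp add: L_def)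
        obtain r :: nat where r: "(I / L + 1) powr (1 / a) < real r" using reals_Archimedean2 by blast
        have "I < L * (I / L + 1)" using L by (simp add: field_simps)
        also have "I / L + 1 = ((I / L + 1) powr (1 / a)) powr a" using a I L by (simp add: powr_powr)
        also have "L * \<dots> \<le> L * (real r + 2) powr a"
          using r L a by (intro mult_left_mono powr_mono2) auto
        finally show ?thesis unfolding L_def by blast
      qed
      then obtain r where "I < K * 2 powr (- \<bar>b $ i\<bar>) * (real r + 2) powr a" by blast
      then show False using ge[of r] I by (simp add: ennreal_le_iff)
    qed
    then show ?thesis using \<theta> by (simp add: SB_modulus_norm_def)
  next
    assume \<theta>: "\<theta> = ereal q" and q: "0 < q" and a: "- 1 \<le> q * (b $ i + 1 / 2 - \<gamma>)"
    define M where "M = (\<Prod>j\<in>UNIV. 2 powr (- \<bar>q * b $ j\<bar>))"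
    have M: "0 < M" unfolding M_def by (intro prod_pos) simp
    let ?W = "\<lambda>t. ennreal (\<Prod>j\<in>UNIV. (1 - log 2 (t $ j)) powr (q * b $ j) / t $ j)"
    let ?U = "{t :: real ^ 'm. \<forall>j. 0 < t $ j \<and> t $ j \<le> 1}"
    have "(\<integral>\<^sup>+ t. ennreal_powr (?\<omega> t) q * ?W t * indicator ?U t \<partial>lebesgue) = \<infinity>"
    proof (rule nn_integral_top_corner_boxes[where i = i and C = "K powr q * M"])
      show "0 < K powr q * M" using K M by simp
      fix r and t :: "real ^ 'm" assume t: "t \<in> corner_box i r"
      have "0 < t $ j \<and> t $ j \<le> 1" for j
      proof -
        have "corner i r $ j / 2 \<le> t $ j" "t $ j \<le> corner i r $ j" using t by (auto simp: corner_box_def)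
        moreover have "corner i r $ j \<le> 1" by (simp add: corner_def)
        ultimately show ?thesis using corner_pos[of i r j] by linarith
      qed
      then have U: "t \<in> ?U" by simp
      let ?x = "real r + 2"
      have "K powr q * M * 4 ^ r / ?x = K powr q * M * 4 ^ r * ?x powr (- 1)"
        by (simp add: powr_minus_divide)
      also have "\<dots> \<le> K powr q * M * 4 ^ r * ?x powr (q * (b $ i + 1 / 2 - \<gamma>))"
        using M a by (intro mult_left_mono powr_mono) auto
      also have "?x powr (q * (b $ i + 1 / 2 - \<gamma>)) = ?x powr ((1 / 2 - \<gamma>) * q) * ?x powr (q * b $ i)"
        by (simp add: powr_add[symmetric] algebra_simps)
      also have "K powr q * M * 4 ^ r * (?x powr ((1 / 2 - \<gamma>) * q) * ?x powr (q * b $ i))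
          = (K * ?x powr (1 / 2 - \<gamma>)) powr q * (?x powr (q * b $ i) * 4 ^ r * M)"
        using K by (simp add: powr_mult powr_powr)
      finally have "ennreal (K powr q * M * 4 ^ r / ?x) \<le> ennreal ((K * ?x powr (1 / 2 - \<gamma>)) powr q * (?x powr (q * b $ i) * 4 ^ r * M))"
        by (rule ennreal_leI)
      also have "\<dots> = ennreal_powr (ennreal (K * ?x powr (1 / 2 - \<gamma>))) q * ennreal (?x powr (q * b $ i) * 4 ^ r * M)"
        using K(1) M by (subst ennreal_powr_ennreal) (simp_all add: ennreal_mult'')
      also have "\<dots> \<le> ennreal_powr (?\<omega> t) q * ?W t"
        unfolding M_def by (intro mult_mono ennreal_powr_mono \<omega> t q ennreal_leI corner_weight_ge) auto
      finally show "ennreal (K powr q * M * 4 ^ r / ?x) \<le> ennreal_powr (?\<omega> t) q * ?W t * indicator ?U t"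
        using U by simp
    qed
    then show ?thesis using \<theta> by (simp add: SB_modulus_norm_def Let_def ennreal_powr_def)
  }
qed

theorem theorem4p4:
  fixes p \<tau> \<beta> :: real and \<theta> :: ereal
    and b v :: "real ^ 'm" and k :: "nat ^ 'm" and j\<^sub>0 :: 'm
  assumes "1 < p" and "1 < \<tau>" and "0 < \<theta>"
    and "\<forall>j. ereal (b $ j) > - (1 / \<theta>)"
    and "\<forall>j. 1 \<le> k $ j"
    and "Min {2, ereal \<tau>, \<theta>} = 2"
    and "(1 < \<tau> \<and> \<tau> \<le> 2 \<and> 1 < p) \<or> (2 < \<tau> \<and> 2 < p)"
    and "\<beta> = (if 1 < \<tau> \<and> \<tau> \<le> 2 \<and> 1 < p then \<tau> else 2)"
    and "\<forall>j. v $ j = b $ j + real_of_ereal (1 / min (ereal \<beta>) \<theta>)"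
  shows "\<forall>\<epsilon>>0. \<exists>f. f \<in> SB_space p \<tau> \<theta> (v - \<epsilon> *\<^sub>R axis j\<^sub>0 1)
              \<and> f \<notin> SB_modulus_space k p \<tau> \<theta> b"
proof (intro allI impI)
  fix \<epsilon> :: real assume \<epsilon>: "0 < \<epsilon>"
  have min2: "(2 :: ereal) = min 2 (min (ereal \<tau>) \<theta>)" using assms(6) by simp
  have "min 2 (min (ereal \<tau>) \<theta>) \<le> min (ereal \<tau>) \<theta>" by (rule min.cobounded2)
  then have "2 \<le> min (ereal \<tau>) \<theta>" using min2 by simp
  then have \<theta>2: "2 \<le> \<theta>" and "2 \<le> \<tau>" by simp_all
  \<comment> \<open>In the branch \<open>\<tau> \<le> 2\<close> the bound
    \<open>2 \<le> \<tau>\<close> forces \<open>\<tau> = 2\<close>.\<close>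
  then have "\<beta> = 2" using assms(8) by auto
  then have min\<beta>: "min (ereal \<beta>) \<theta> = 2" using \<theta>2 by (simp add: min_def)
  have v: "v $ j = b $ j + 1 / 2" for j
  proof -
    have "(1 :: ereal) / 2 = ereal (1 / 2)"
      by (simp add: divide_ereal_def)
    then show ?thesis using assms(9) unfolding min\<beta> by simp
  qed
  define r where "r = v - \<epsilon> *\<^sub>R axis j\<^sub>0 1"
  have r: "r $ j\<^sub>0 = b $ j\<^sub>0 + 1 / 2 - \<epsilon>" by (simp add: r_def v)
  obtain \<gamma> q where \<gamma>: "1 / 2 < \<gamma>"
    and up: "\<theta> = \<infinity> \<and> r $ j\<^sub>0 \<le> \<gamma> \<or> \<theta> = ereal q \<and> 0 < q \<and> (r $ j\<^sub>0 - \<gamma>) * q < - 1"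
    and lo: "\<theta> = \<infinity> \<and> \<gamma> < b $ j\<^sub>0 + 1 / 2 \<or> \<theta> = ereal q \<and> 0 < q \<and> - 1 \<le> q * (b $ j\<^sub>0 + 1 / 2 - \<gamma>)"
  proof (cases \<theta>)
    case PInf
    then have b: "0 < b $ j\<^sub>0" using assms(4) by (auto dest: spec[of _ j\<^sub>0])
    \<comment> \<open>Here \<open>\<gamma>\<close> must be strictly below
      \<open>b $ j\<^sub>0 + 1 / 2\<close> but within \<open>\<epsilon>\<close> of it; capping the
      loss at \<open>b $ j\<^sub>0 / 2\<close> keeps it above 1/2. The value 1 for \<open>q\<close>
      is a dummy.\<close>
    show thesis
      using PInf b \<epsilon> r by (intro that[of "b $ j\<^sub>0 + 1 / 2 - min \<epsilon> (b $ j\<^sub>0 / 2)" 1]) (auto simp: min_def)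
  next
    case (real q)
    then have q: "2 \<le> q" using \<theta>2 by simp
    then have b: "- (1 / q) < b $ j\<^sub>0" using assms(4) real by (auto simp: one_ereal_def dest: spec[of _ j\<^sub>0])
    \<comment> \<open>With this \<open>\<gamma>\<close> the modulus integral is exactly harmonic,
      with exponent \<open>- 1\<close>, while the series in the first norm has exponent
      \<open>- 1 - \<epsilon> * q\<close>.\<close>
    show thesis
    proof (rule that[of "b $ j\<^sub>0 + 1 / 2 + 1 / q" q])
      show "1 / 2 < b $ j\<^sub>0 + 1 / 2 + 1 / q" using b by linarith
      have "(r $ j\<^sub>0 - (b $ j\<^sub>0 + 1 / 2 + 1 / q)) * q = - 1 - \<epsilon> * q" using q by (simp add: r field_simps)
      moreover have "0 < \<epsilon> * q" using \<epsilon> q by simp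
      ultimately show "\<theta> = \<infinity> \<and> r $ j\<^sub>0 \<le> b $ j\<^sub>0 + 1 / 2 + 1 / q \<or> \<theta> = ereal q \<and> 0 < q \<and> (r $ j\<^sub>0 - (b $ j\<^sub>0 + 1 / 2 + 1 / q)) * q < - 1"
        using real q by simp
      show "\<theta> = \<infinity> \<and> b $ j\<^sub>0 + 1 / 2 + 1 / q < b $ j\<^sub>0 + 1 / 2 \<or> \<theta> = ereal q \<and> 0 < q \<and> - 1 \<le> q * (b $ j\<^sub>0 + 1 / 2 - (b $ j\<^sub>0 + 1 / 2 + 1 / q))"
        using real q by simp
    qed
  qed (use assms(3) in simp)
  have p: "0 < p" "0 < \<tau>" "0 < \<gamma>" using assms(1,2) \<gamma> by auto
  obtain N where N: "strict_mono N"
    and small: "\<And>l. (\<Sum>s\<in>{N l..<N (Suc l)}. (norm (power_coeff \<gamma> s))\<^sup>2) \<le> (1 * (1 / 2) ^ l)\<^sup>2"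
    using summable_subsequence_blocks[OF summable_power_coeff[OF \<gamma>] zero_less_one] by blast
  have N': "N l \<le> N (Suc l)" for l using N by (simp add: strict_mono_less_eq)
  let ?f = "\<lambda>x. Re (lac_limit j\<^sub>0 (power_coeff \<gamma>) N x)"
  have "?f \<in> lorentz_space0 p \<tau>"
    by (rule lac_limit_in_lorentz_space0[OF N zero_less_one small p(1,2) summable_power_coeff[OF \<gamma>]])
  moreover have "SB_norm p \<tau> \<theta> r ?f < \<infinity>"
    by (rule SB_norm_lac_limit_finite[OF N' zero_less_one small p(1,2) up])
  moreover have "SB_modulus_norm k p \<tau> \<theta> b ?f = \<infinity>"
    by (rule SB_modulus_norm_lac_limit_infinite[OF N zero_less_one small p lo])
  ultimately show "\<exists>f. f \<in> SB_space p \<tau> \<theta> (v - \<epsilon> *\<^sub>R axis j\<^sub>0 1) \<and> f \<notin> SB_modulus_space k p \<tau> \<theta> b"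
    unfolding r_def[symmetric] SB_space_def SB_modulus_space_def by (intro exI[of _ ?f]) simp
qed

end
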